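(* Let $m\in\mathbb{Z}^+$ and $c\in\mathbb{C}^m$. For $m_2=1$ and every integer $m_1>2$, the Fermat-type partial differential-difference equation $$\left(\sum_{j=1}^m\frac{\partial f(z)}{\partial z_j}\right)^{m_1}+f^{m_2}(z+c)=1$$ does not have any finite order transcendental entire solution $f$ on $\mathbb{C}^m$.
   Context: Here $z=(z_1,\ldots,z_m)$ and $f^{k}(z+c)$ means $(f(z+c))^k$. An entire function is transcendental if it is not a polynomial. The order of $f$ is $\rho(f)=\limsup_{r\to\infty}\frac{\log T(r,f)}{\log r}$, and $f$ has finite order if $\rho(f)<+\infty$. Here $T(r,f)$ is the Nevanlinna characteristic in $\mathbb{C}^m$; for entire $f$, $T(r,f)=\int_{\|z\|=r}\log^+|f|\,\sigma_m$, where, with $i$ the imaginary unit, $\tau_m(z)=\|z\|^2$, $d^c=\frac{i}{4\pi}(\bar\partial-\partial)$ and $\omega_m=dd^c\log\tau_m$, one sets $\sigma_m=d^c\log\tau_m\wedge\omega_m^{m-1}$. *)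

theory Defs
  imports "HOL-Analysis.Analysis"
begin

section \<open>Entire functions on complex m-space\<close>

definition entire_Cm :: "(complex^'m \<Rightarrow> complex) \<Rightarrow> bool" where
  "entire_Cm f \<longleftrightarrow>
     (\<forall>z. \<exists>L. (f has_derivative L) (at z) \<and> (\<forall>a v. L (a *s v) = a * L v))"

definition polynomial_Cm :: "(complex^'m \<Rightarrow> complex) \<Rightarrow> bool" where
  "polynomial_Cm f \<longleftrightarrow>
     (\<exists>(A :: ('m \<Rightarrow> nat) set) a. finite A \<and>
        (\<forall>z. f z = (\<Sum>\<alpha>\<in>A. a \<alpha> * (\<Prod>j\<in>UNIV. (z $ j) ^ \<alpha> j))))"

definition transcendental_Cm :: "(complex^'m \<Rightarrow> complex) \<Rightarrow> bool" where
  "transcendental_Cm f \<longleftrightarrow> \<not> polynomial_Cm f"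

definition partial_Cm :: "'m \<Rightarrow> (complex^'m \<Rightarrow> complex) \<Rightarrow> complex^'m \<Rightarrow> complex" where
  "partial_Cm j f z = deriv (\<lambda>t. f (z + axis j t)) 0"


section \<open>Differential forms\<close>

text \<open>
  A \<open>k\<close>-form at a point is represented by its values on tuples \<open>v 0, \<dots>, v (k - 1)\<close> of
  tangent vectors; later entries of \<open>v\<close> are ignored. The wedge product is normalised so
  that the value of \<open>dx\<^sub>1 \<and> \<dots> \<and> dx\<^sub>n\<close> on the standard basis is 1.
\<close>

type_synonym 'v form = "(nat \<Rightarrow> 'v) \<Rightarrow> complex"

definition wedge :: "nat \<Rightarrow> nat \<Rightarrow> 'v form \<Rightarrow> 'v form \<Rightarrow> 'v form" where
  "wedge p q \<alpha> \<beta> v =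
     (\<Sum>\<pi> | \<pi> permutes {..<p + q}.
        of_int (sign \<pi>) * \<alpha> (\<lambda>i. v (\<pi> i)) * \<beta> (\<lambda>i. v (\<pi> (p + i)))) / (fact p * fact q)"

text \<open>The \<open>k\<close>-fold wedge power of a 2-form.\<close>

primrec wedge_power2 :: "nat \<Rightarrow> 'v form \<Rightarrow> 'v form" where
  "wedge_power2 0 \<omega> = (\<lambda>v. 1)"
| "wedge_power2 (Suc k) \<omega> = wedge 2 (2 * k) \<omega> (wedge_power2 k \<omega>)"

text \<open>
  The (1,0)- and (0,1)-parts of the differential of a real function \<open>u\<close>, i.e.
  \<open>\<Sum>\<^sub>j \<partial>u/\<partial>z\<^sub>j dz\<^sub>j\<close> and \<open>\<Sum>\<^sub>j \<partial>u/\<partial>z\<^sub>j\<^sup>* dz\<^sub>j\<^sup>*\<close> (\<open>*\<close> being conjugation), are its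
  complex linear and complex antilinear parts.
\<close>

definition del_form :: "(complex^'m \<Rightarrow> real) \<Rightarrow> complex^'m \<Rightarrow> (complex^'m) form" where
  "del_form u z v =
     (of_real (frechet_derivative u (at z) (v 0))
       - \<i> * of_real (frechet_derivative u (at z) (\<i> *s v 0))) / 2"

definition delbar_form :: "(complex^'m \<Rightarrow> real) \<Rightarrow> complex^'m \<Rightarrow> (complex^'m) form" where
  "delbar_form u z v =
     (of_real (frechet_derivative u (at z) (v 0))
       + \<i> * of_real (frechet_derivative u (at z) (\<i> *s v 0))) / 2"

definition dc_form :: "(complex^'m \<Rightarrow> real) \<Rightarrow> complex^'m \<Rightarrow> (complex^'m) form" where
  "dc_form u z v = \<i> / (4 * of_real pi) * (delbar_form u z v - del_form u z v)"

text \<open>Exterior derivative of a field of 1-forms, evaluated on constant vector fields.\<close>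

definition ext_deriv1 :: "('v::real_normed_vector \<Rightarrow> 'v form) \<Rightarrow> 'v \<Rightarrow> 'v form" where
  "ext_deriv1 \<eta> z v =
     frechet_derivative (\<lambda>y. \<eta> y (\<lambda>_. v 1)) (at z) (v 0)
       - frechet_derivative (\<lambda>y. \<eta> y (\<lambda>_. v 0)) (at z) (v 1)"

definition tau :: "complex^'m \<Rightarrow> real" where
  "tau z = (norm z)\<^sup>2"

definition omega_form :: "complex^'m \<Rightarrow> (complex^'m) form" where
  "omega_form = ext_deriv1 (dc_form (\<lambda>z. ln (tau z)))"

definition sigma_form :: "complex^'m \<Rightarrow> (complex^'m) form" where
  "sigma_form z =
     wedge 1 (2 * (CARD('m) - 1)) (dc_form (\<lambda>z. ln (tau z)) z)
       (wedge_power2 (CARD('m) - 1) (omega_form z))"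


section \<open>Integration over spheres\<close>

text \<open>
  A positively oriented real basis \<open>e\<^sub>1, \<i>e\<^sub>1, e\<^sub>2, \<i>e\<^sub>2, \<dots>\<close>. The orientation does not
  depend on the enumeration of the index type, since only pairs of vectors get permuted.
\<close>

definition std_frame :: "nat \<Rightarrow> complex^'m" where
  "std_frame i = axis (from_nat_into UNIV (i div 2)) (if even i then 1 else \<i>)"

definition radial_proj :: "real \<Rightarrow> complex^'m \<Rightarrow> complex^'m" where
  "radial_proj r x = (r / norm x) *\<^sub>R x"

text \<open>
  The integral of a form \<open>\<eta>\<close> of degree \<open>2m - 1\<close> over the sphere of radius \<open>r > 0\<close>, oriented
  as the boundary of the ball. With \<open>P\<close> the radial projection onto the sphere and
  \<open>\<rho>(x) = \<parallel>x\<parallel>\<close>, the map \<open>(\<rho>, P)\<close> is an orientation preserving diffeomorphism from the shell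
  \<open>1 < \<rho> < 2\<close> to the product of the interval \<open>]1, 2[\<close>, which has length 1, and the sphere.
  By Fubini the integral of \<open>\<eta>\<close> over the sphere is that of the top degree form
  \<open>d\<rho> \<and> P\<^sup>*\<eta>\<close> over the shell; the latter is a Lebesgue integral.
\<close>

definition sphere_integral :: "real \<Rightarrow> (complex^'m \<Rightarrow> (complex^'m) form) \<Rightarrow> complex" where
  "sphere_integral r \<eta> =
     (LINT x : {x. 1 < norm x \<and> norm x < 2} | lborel.
        wedge 1 (2 * CARD('m) - 1)
          (\<lambda>v. of_real (frechet_derivative norm (at x) (v 0)))
          (\<lambda>v. \<eta> (radial_proj r x) (\<lambda>i. frechet_derivative (radial_proj r) (at x) (v i)))
          std_frame)"


section \<open>Nevanlinna characteristic and order\<close>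

definition log_plus :: "real \<Rightarrow> real" where
  "log_plus x = ln (max 1 x)"

text \<open>\<open>Re\<close> only changes the type: the form \<open>sigma_form\<close> is real.\<close>

definition nevanlinna_T :: "real \<Rightarrow> (complex^'m \<Rightarrow> complex) \<Rightarrow> real" where
  "nevanlinna_T r f =
     Re (sphere_integral r (\<lambda>z v. of_real (log_plus (cmod (f z))) * sigma_form z v))"

text \<open>Since \<open>ln 0 = 0\<close> in the library, \<open>log 0 = -\<infinity>\<close> is made explicit.\<close>

definition order_Cm :: "(complex^'m \<Rightarrow> complex) \<Rightarrow> ereal" where
  "order_Cm f =
     Limsup at_top (\<lambda>r. if nevanlinna_T r f = 0 then -\<infinity>
                        else ereal (ln (nevanlinna_T r f) / ln r))"

definition finite_order_Cm :: "(complex^'m \<Rightarrow> complex) \<Rightarrow> bool" where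
  "finite_order_Cm f \<longleftrightarrow> order_Cm f < \<infinity>"

end

theory Submission
  imports Defs "HOL-Complex_Analysis.Complex_Analysis"
begin

text \<open>
  Write \<open>D\<close> for the sum of the partial derivatives, the derivative in the direction
  \<open>e = (1, \<dots>, 1)\<close>, and \<open>n\<close> for the exponent \<open>m\<^sub>1 \<ge> 3\<close>. The point of the proof is that the equation
  \<open>f(z + c) = 1 - (D f(z))\<^sup>n\<close>, read backwards, bounds \<open>D f\<close> at \<open>z\<close> by an \<open>n\<close>-th root of a value of \<open>f\<close> at
  \<open>z + c\<close>. Along the sequence \<open>z, z + c, z + 2 c, \<dots>\<close> these roots accumulate, so that growth of
  \<open>log\<^sup>+ \<bar>f\<bar>\<close> slower than \<open>n\<^sup>j\<close> along \<open>z + j c\<close> is as good as no growth at all.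

  Applied to the whole complex lines \<open>z + j c + t e\<close>, this gives \<open>\<bar>D f(z + t e)\<bar> \<le> const * sqrt \<bar>t\<bar>\<close> for large
  \<open>\<bar>t\<bar>\<close>, with a constant depending on \<open>z\<close>. By the Cauchy estimates \<open>D (D f)\<close> vanishes, and
  applying \<open>D\<close> to the equation gives \<open>D f = 0\<close>, so \<open>f\<close> is the constant \<open>1\<close>. The exponent \<open>1/2\<close>
  is available precisely because \<open>n \<ge> 3\<close>. This part is \<open>no_slow_growth_solution\<close>; it only uses a pointwise polynomial
  bound of \<open>log\<^sup>+ \<bar>f\<bar>\<close>.

  That bound is \<open>log_plus_polynomial_growth\<close>. Finite order bounds the Nevanlinna characteristic \<open>T(r, f)\<close> by
  a power of \<open>r\<close>, and two facts are needed to pass to values of \<open>f\<close>. First, \<open>T(r, f)\<close> is an integral of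
  \<open>log\<^sup>+ \<bar>f\<bar>\<close> against a positive density that is bounded below
  (\<open>sphere_integral_eq\<close>, \<open>shell_density_lower\<close>). This is linear algebra of alternating forms: next to
  \<open>d\<rho> \<and> d\<^sup>c log \<tau>\<close> the Fubini--Study form may be replaced by a multiple of the Euclidean symplectic form, and the resulting
  top degree form is evaluated on the standard frame. Second, \<open>log\<^sup>+ \<bar>f\<bar>\<close> has the sub-mean value property on
  balls (\<open>log_plus_sub_mean_value\<close>); it follows from the maximum principle for the product of \<open>f\<close> over the vertices of a
  regular polygon on a circle, and from the rotation invariance of Lebesgue measure.
\<close>

section \<open>Solutions of polynomial logarithmic growth are constant\<close>

abbreviation ones :: "complex^'m" where "ones \<equiv> \<chi> j. 1"

definition diag_deriv :: "(complex^'m \<Rightarrow> complex) \<Rightarrow> complex^'m \<Rightarrow> complex" where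
  "diag_deriv f z = (\<Sum>j\<in>UNIV. partial_Cm j f z)"

lemma entire_Cm_line_derivative:
  fixes f :: "complex^'m \<Rightarrow> complex"
  assumes "entire_Cm f"
  obtains L where "linear L"
    "\<And>p v t. p + t *s v = y \<Longrightarrow> ((\<lambda>t. f (p + t *s v)) has_field_derivative L v) (at t)"
proof -
  obtain L where L: "(f has_derivative L) (at y)" and lin: "\<And>a w. L (a *s w) = a * L w"
    using assms unfolding entire_Cm_def by blast
  have "((\<lambda>t. f (p + t *s v)) has_field_derivative L v) (at t)" if "p + t *s v = y" for p v t
  proof -
    have "linear (\<lambda>h. h *s v)"
      by (auto intro!: linearI simp: vec_eq_iff algebra_simps)
    then have "((\<lambda>t. t *s v) has_derivative (\<lambda>h. h *s v)) (at t)"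
      by (intro bounded_linear_imp_has_derivative) (simp add: linear_conv_bounded_linear)
    then have g: "((\<lambda>t. p + t *s v) has_derivative (\<lambda>h. h *s v)) (at t)"
      by (auto intro: derivative_eq_intros)
    have "((\<lambda>t. f (p + t *s v)) has_derivative (\<lambda>h. L (h *s v))) (at t)"
      using has_derivative_compose[OF g, of f L] L that by simp
    then have "((\<lambda>t. f (p + t *s v)) has_derivative (*) (L v)) (at t)"
      unfolding lin by (simp add: mult.commute[of _ "L v"])
    then show ?thesis unfolding has_field_derivative_def .
  qed
  with has_derivative_linear[OF L] that show thesis by blast
qed

lemma entire_Cm_line_holomorphic:
  assumes "entire_Cm f"
  shows "(\<lambda>t. f (z + t *s v)) holomorphic_on UNIV"
proof -
  have "\<exists>d. ((\<lambda>t. f (z + t *s v)) has_field_derivative d) (at t)" for t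
    using entire_Cm_line_derivative[OF assms, of "z + t *s v"] by metis
  then show ?thesis
    by (auto simp: holomorphic_on_def field_differentiable_def intro: DERIV_subset)
qed

text \<open>
  On a complex line in the direction \<open>(1, \<dots>, 1)\<close> the differential operator of the equation is the
  ordinary derivative. This turns the equation into recursions between functions of one variable.
\<close>

lemma diag_deriv_line:
  fixes f :: "complex^'m \<Rightarrow> complex"
  assumes "entire_Cm f"
  shows "((\<lambda>t. f (z + t *s ones)) has_field_derivative diag_deriv f (z + t *s ones)) (at t)"
proof -
  define y where "y = z + t *s ones"
  obtain L where lin: "linear L"
    and line: "\<And>p v s. p + s *s v = y \<Longrightarrow> ((\<lambda>s. f (p + s *s v)) has_field_derivative L v) (at s)"
    using entire_Cm_line_derivative[OF assms, of y] by metis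
  have "partial_Cm j f y = L (axis j 1)" for j
  proof -
    have ax: "s *s axis j 1 = axis j s" for s :: complex
      by (auto simp: vec_eq_iff axis_def)
    have "((\<lambda>s. f (y + axis j s)) has_field_derivative L (axis j 1)) (at 0)"
      using line[of y 0 "axis j 1"] by (simp add: ax)
    then show ?thesis unfolding partial_Cm_def by (rule DERIV_imp_deriv)
  qed
  then have "diag_deriv f y = (\<Sum>j\<in>UNIV. L (axis j 1))" by (simp add: diag_deriv_def)
  also have "\<dots> = L (\<Sum>j\<in>UNIV. axis j 1)" by (simp add: linear_sum[OF lin])
  also have "(\<Sum>j\<in>UNIV. axis j (1::complex)) = ones"
    by (simp add: vec_eq_iff axis_def)
  finally show ?thesis using line[of z t ones] y_def by simp
qed

text \<open>
  The inductive step of the growth bound: if \<open>E = exp (C n\<^sup>j)\<close> bounds a function at \<open>0\<close>, and its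
  \<open>n\<close>-th power changes on the disc of radius \<open>R\<close> by at most \<open>R\<close> times the bound claimed for the
  next index, \<open>sqrt (2 R) E\<^sup>n\<close>, then it is at most \<open>sqrt (2 R) E\<close> on that disc. The factor
  \<open>X = sqrt (2 R)\<close> reproduces itself since \<open>X\<^sup>n \<ge> X\<^sup>3 = 2 R X \<ge> 1 + R X\<close>; this is where \<open>n \<ge> 3\<close> enters,
  and it makes the resulting bound sublinear in \<open>R\<close>.
\<close>

lemma growth_step:
  fixes a R C :: real and n j :: nat
  assumes n: "n \<ge> 3" and R: "R \<ge> 1" and a: "0 \<le> a"
    and b: "a ^ n \<le> exp (C * real n ^ j) ^ n + R * (sqrt (2 * R) * exp (C * real n ^ Suc j))"
  shows "a \<le> sqrt (2 * R) * exp (C * real n ^ j)"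
proof (rule ccontr)
  define X where "X = sqrt (2 * R)"
  define E where "E = exp (C * real n ^ Suc j)"
  have E: "exp (C * real n ^ j) ^ n = E" unfolding E_def
    by (simp add: exp_of_nat_mult[symmetric] mult_ac)
  have X1: "X \<ge> 1" using R by (simp add: X_def)
  have X2: "X ^ 2 = 2 * R" using R by (simp add: X_def)
  assume "\<not> ?thesis"
  then have "(X * exp (C * real n ^ j)) ^ n < a ^ n"
    using X1 n by (intro power_strict_mono) (auto simp: X_def)
  then have "X ^ n * E < E + R * (X * E)"
    using b by (simp add: power_mult_distrib E X_def[symmetric] E_def[symmetric] del: power_Suc)
  moreover have "X ^ 3 * E \<le> X ^ n * E"
    using power_increasing[OF n X1] by (simp add: E_def)
  moreover have "X ^ 3 = 2 * R * X" using X2 by (simp add: power3_eq_cube power2_eq_square)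
  moreover have "E \<le> R * X * E" 
    using R X1 mult_mono[of 1 R 1 X] by (simp add: E_def)
  ultimately show False by (simp add: algebra_simps)
qed

lemma poly_le_exp:
  fixes A B :: real and n K :: nat
  assumes "n \<ge> 2"
  shows "eventually (\<lambda>j. A * (B + real j) ^ K \<le> real n ^ j) sequentially"
proof -
  have "(\<lambda>j. A * (B + real j) ^ K / 2 ^ j) \<longlonglongrightarrow> 0" by real_asymp
  then have "eventually (\<lambda>j. A * (B + real j) ^ K / 2 ^ j < 1) sequentially"
    by (rule order_tendstoD) simp
  then show ?thesis
  proof eventually_elim
    case (elim j)
    then have "A * (B + real j) ^ K \<le> 2 ^ j" by (simp add: field_simps)
    also have "\<dots> \<le> real n ^ j" using assms by (intro power_mono) auto
    finally show ?case .
  qed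
qed

text \<open>
  For fixed \<open>z\<close> let \<open>\<phi>\<^sub>j(t) = f (z + j c + t (1, \<dots>, 1))\<close> and \<open>G\<^sub>j = \<phi>\<^sub>j'\<close>, so that the equation reads
  \<open>G\<^sub>j\<^sup>n = 1 - \<phi>\<^sub>j\<^sub>+\<^sub>1\<close>. Differentiation gives \<open>(G\<^sub>j\<^sup>n)' = - G\<^sub>j\<^sub>+\<^sub>1\<close>, hence a bound of \<open>G\<^sub>j\<^sub>+\<^sub>1\<close> on a disc
  yields one of \<open>G\<^sub>j\<close>, with an \<open>n\<close>-th root taken. Going from \<open>j = N\<close> down to \<open>j = 0\<close> takes \<open>N\<close> roots,
  and since \<open>log \<bar>G\<^sub>N\<bar>\<close> grows only polynomially in \<open>N\<close>, its share in the bound of \<open>G\<^sub>0\<close> disappears.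
  What is left is \<open>\<bar>G\<^sub>0(t)\<bar> \<le> const * sqrt R\<close> for \<open>\<bar>t\<bar> \<le> R\<close>, with a constant independent of \<open>R\<close>.
  So \<open>G\<^sub>0' (0) = 0\<close>, and as \<open>z\<close> is arbitrary, differentiating the equation once more shows that the
  operator annihilates \<open>f\<close>.
\<close>

proposition no_slow_growth_solution:
  fixes f :: "complex^'m \<Rightarrow> complex"
  assumes f: "entire_Cm f" and n: "n \<ge> 3"
    and eq: "\<And>z. diag_deriv f z ^ n + f (z + c) = 1"
    and growth: "\<And>z. log_plus (cmod (f z)) \<le> A * (1 + norm z) ^ K" and A: "A \<ge> 0"
  shows "f z = 1"
proof -
  have fb: "cmod (f z) \<le> exp (A * (1 + norm z) ^ K)" for z
  proof -
    have "cmod (f z) \<le> max 1 (cmod (f z))" by simp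
    also have "\<dots> = exp (log_plus (cmod (f z)))" by (simp add: log_plus_def)
    also have "\<dots> \<le> exp (A * (1 + norm z) ^ K)" using growth by simp
    finally show ?thesis .
  qed
  have Gb: "cmod (diag_deriv f z) \<le> exp (1 + A * (1 + norm (z + c)) ^ K)" for z
  proof -
    define M where "M = exp (A * (1 + norm (z + c)) ^ K)"
    have M: "1 \<le> M" using A by (simp add: M_def)
    have "cmod (diag_deriv f z) ^ n = cmod (1 - f (z + c))"
      using eq[of z] by (metis add_diff_cancel_right' norm_power)
    also have "\<dots> \<le> 1 + cmod (f (z + c))" using norm_triangle_ineq4[of 1 "f (z + c)"] by simp
    also have "\<dots> \<le> 2 * M" using fb[of "z + c"] M unfolding M_def by linarith
    also have "\<dots> \<le> exp 1 * M" using M exp_ge_add_one_self[of 1] by (intro mult_right_mono) auto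
    finally have le: "cmod (diag_deriv f z) ^ n \<le> exp 1 * M" .
    have ge: "1 \<le> exp 1 * M" using M mult_mono[of 1 "exp 1" 1 M] by simp
    have "cmod (diag_deriv f z) \<le> exp 1 * M"
    proof (cases "cmod (diag_deriv f z) \<le> 1")
      case False
      then have "cmod (diag_deriv f z) ^ 1 \<le> cmod (diag_deriv f z) ^ n"
        using n by (intro power_increasing) auto
      then show ?thesis using le by simp
    qed (use ge in simp)
    then show ?thesis by (simp add: M_def exp_add)
  qed
  have DG0: "((\<lambda>t. diag_deriv f (z + t *s ones)) has_field_derivative 0) (at 0)" for z
  proof -
    define \<phi> where "\<phi> j t = f (z + of_nat j *s c + t *s ones)" for j :: nat and t
    define G where "G j t = diag_deriv f (z + of_nat j *s c + t *s ones)" for j :: nat and t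
    have dphi: "(\<phi> j has_field_derivative G j t) (at t)" for j t
      unfolding \<phi>_def G_def by (rule diag_deriv_line[OF f])
    have Geq: "G j t ^ n = 1 - \<phi> (Suc j) t" for j t
    proof -
      have "z + of_nat (Suc j) *s c + t *s ones = z + of_nat j *s c + t *s ones + c"
        by (simp add: vec_eq_iff algebra_simps)
      then have "G j t ^ n + \<phi> (Suc j) t = 1"
        unfolding G_def \<phi>_def by (simp only: eq)
      then show ?thesis by (metis add_diff_cancel_right')
    qed
    have Ghol: "G j holomorphic_on UNIV" for j
    proof -
      have "\<phi> j holomorphic_on UNIV"
        using dphi by (meson holomorphic_onI DERIV_subset field_differentiable_def subset_UNIV)
      moreover have "deriv (\<phi> j) = G j" using dphi by (auto intro!: ext DERIV_imp_deriv)
      ultimately show ?thesis using holomorphic_deriv[of "\<phi> j" UNIV] by simp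
    qed
    define B where "B R = 1 + norm z + R * norm (ones::complex^'m) + norm c" for R
    have npos: "norm (of_nat k *s c) = real k * norm c" for k
    proof -
      have "of_nat k *s c = real k *\<^sub>R c" by (simp add: vec_eq_iff scaleR_conv_of_real[where 'a = complex])
      then show ?thesis by simp
    qed
    have nt: "norm (t *s (ones::complex^'m)) = norm t * norm (ones::complex^'m)" for t :: complex
      by (simp add: norm_vec_def L2_set_def norm_mult power_mult_distrib real_sqrt_mult)
    have Gjb: "cmod (G j t) \<le> exp (1 + A * ((1 + norm c) * (B R + j)) ^ K)"
      if t: "cmod t \<le> R" for j t R
    proof -
      have R: "R \<ge> 0" using t norm_ge_zero order_trans by blast
      have "norm (z + of_nat j *s c + t *s ones + c) 
          \<le> norm z + norm (of_nat j *s c) + norm (t *s (ones::complex^'m)) + norm c"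
        by (meson norm_triangle_mono order_refl)
      also have "\<dots> \<le> norm z + real j * norm c + R * norm (ones::complex^'m) + norm c"
        using t by (simp add: npos nt mult_right_mono)
      finally have "1 + norm (z + of_nat j *s c + t *s ones + c) \<le> B R + real j * norm c"
        by (simp add: B_def)
      also have "\<dots> \<le> (1 + norm c) * (B R + real j)"
      proof -
        have "0 \<le> B R" using R by (simp add: B_def)
        then have "0 \<le> norm c * B R" by simp
        then show ?thesis by (simp add: algebra_simps)
      qed
      finally have "(1 + norm (z + of_nat j *s c + t *s ones + c)) ^ K \<le> ((1 + norm c) * (B R + j)) ^ K"
        by (intro power_mono) auto
      then have "1 + A * (1 + norm (z + of_nat j *s c + t *s ones + c)) ^ K
          \<le> 1 + A * ((1 + norm c) * (B R + j)) ^ K" using A by (simp add: mult_left_mono)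
      with Gb[of "z + of_nat j *s c + t *s ones"] show ?thesis
        unfolding G_def by (meson exp_le_cancel_iff order_trans)
    qed
    have ev: "eventually (\<lambda>j. \<forall>t. cmod t \<le> R \<longrightarrow> cmod (G j t) \<le> exp (2 * real n ^ j)) sequentially" for R
    proof -
      have "eventually (\<lambda>j. A * (1 + norm c) ^ K * (B R + real j) ^ K \<le> real n ^ j) sequentially"
        using n by (intro poly_le_exp) auto
      then show ?thesis
      proof eventually_elim
        case (elim j)
        have "1 \<le> real n ^ j" using n by simp
        with elim have "1 + A * ((1 + norm c) * (B R + j)) ^ K \<le> 2 * real n ^ j"
          by (simp add: power_mult_distrib mult_ac)
        then show ?case using Gjb by (meson exp_le_cancel_iff order_trans)
      qed
    qed
    \<comment> \<open>One constant for all \<open>j\<close>, chosen before the radius \<open>R\<close>; the finitely many small \<open>j\<close> are absorbed by a maximum.\<close>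
    obtain C where C2: "C \<ge> 2" and C: "\<And>j. cmod (G j 0) \<le> exp (C * real n ^ j)"
    proof -
      obtain N where N: "\<And>j. j \<ge> N \<Longrightarrow> cmod (G j 0) \<le> exp (2 * real n ^ j)"
        using ev[of 0] unfolding eventually_sequentially by auto
      define C where "C = Max (insert 2 ((\<lambda>j. ln (cmod (G j 0))) ` {..<N}))"
      have C2: "C \<ge> 2" unfolding C_def by (intro Max_ge) auto
      have "cmod (G j 0) \<le> exp (C * real n ^ j)" for j
      proof -
        have n1: "1 \<le> real n ^ j" using n by simp
        show ?thesis
        proof (cases "j < N \<and> G j 0 \<noteq> 0")
          case True
          then have "ln (cmod (G j 0)) \<le> C" unfolding C_def by (intro Max_ge) auto
          also have "\<dots> \<le> C * real n ^ j" using n1 C2 by simp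
          finally have "exp (ln (cmod (G j 0))) \<le> exp (C * real n ^ j)" by simp
          then show ?thesis using True by simp
        next
          case False
          show ?thesis
          proof (cases "G j 0 = 0")
            case fl: False
            have "exp (2 * real n ^ j) \<le> exp (C * real n ^ j)" using C2 n1 by (simp add: mult_right_mono)
            with N[of j] False fl show ?thesis by (meson leI order_trans)
          qed simp
        qed
      qed
      with C2 that show thesis by blast
    qed
    have main: "cmod (G 0 t) \<le> sqrt (2 * R) * exp C" if R: "R \<ge> 1" and t: "cmod t \<le> R" for R t
    proof -
      obtain N where N: "\<And>t. cmod t \<le> R \<Longrightarrow> cmod (G N t) \<le> exp (2 * real n ^ N)"
        using ev[of R] unfolding eventually_sequentially by auto
      \<comment> \<open>Downward induction from \<open>N\<close>, which depends on \<open>R\<close> but leaves no trace in the bound.\<close>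
      have "\<forall>t. cmod t \<le> R \<longrightarrow> cmod (G 0 t) \<le> sqrt (2 * R) * exp (C * real n ^ 0)"
      proof (rule inc_induct[of 0 N])
        show "\<forall>t. cmod t \<le> R \<longrightarrow> cmod (G N t) \<le> sqrt (2 * R) * exp (C * real n ^ N)"
        proof (intro allI impI)
          fix t assume "cmod t \<le> R"
          then have "cmod (G N t) \<le> exp (2 * real n ^ N)" by (rule N)
          also have "\<dots> \<le> exp (C * real n ^ N)" using C2 by (simp add: mult_right_mono)
          also have "\<dots> \<le> sqrt (2 * R) * exp (C * real n ^ N)"
            using R by simp
          finally show "cmod (G N t) \<le> sqrt (2 * R) * exp (C * real n ^ N)" .
        qed
      next
        fix j assume IH: "\<forall>t. cmod t \<le> R \<longrightarrow> cmod (G (Suc j) t) \<le> sqrt (2 * R) * exp (C * real n ^ Suc j)"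
        show "\<forall>t. cmod t \<le> R \<longrightarrow> cmod (G j t) \<le> sqrt (2 * R) * exp (C * real n ^ j)"
        proof (intro allI impI)
          fix t assume t: "cmod t \<le> R"
          let ?M = "sqrt (2 * R) * exp (C * real n ^ Suc j)"
          have "cmod (\<phi> (Suc j) t - \<phi> (Suc j) 0) \<le> ?M * cmod (t - 0)"
          proof (rule field_differentiable_bound[of "cball 0 R" _ "G (Suc j)"])
            show "(\<phi> (Suc j) has_field_derivative G (Suc j) s) (at s within cball 0 R)" for s
              using dphi[of "Suc j" s] DERIV_subset by blast
          qed (use IH t R in auto)
          also have "\<dots> \<le> ?M * R" using t R by (intro mult_left_mono mult_nonneg_nonneg) auto
          finally have d: "cmod (\<phi> (Suc j) t - \<phi> (Suc j) 0) \<le> R * ?M" by (simp add: mult.commute)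
          have "G j t ^ n = G j 0 ^ n - (\<phi> (Suc j) t - \<phi> (Suc j) 0)" by (simp add: Geq)
          then have "cmod (G j t) ^ n \<le> cmod (G j 0) ^ n + cmod (\<phi> (Suc j) t - \<phi> (Suc j) 0)"
            by (metis norm_power norm_triangle_ineq4)
          also have "\<dots> \<le> exp (C * real n ^ j) ^ n + R * ?M"
            using d C[of j] by (intro add_mono power_mono) auto
          finally show "cmod (G j t) \<le> sqrt (2 * R) * exp (C * real n ^ j)"
            using C2 by (intro growth_step[OF n R]) auto
        qed
      qed simp
      with t show ?thesis by simp
    qed
    have der: "(G 0 has_field_derivative deriv (G 0) 0) (at 0)"
      using Ghol[of 0] by (metis UNIV_I holomorphic_derivI open_UNIV)
    have "cmod (deriv (G 0) 0) \<le> sqrt 2 * exp C / sqrt R" if R: "R \<ge> 1" for R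
    proof -
      have "cmod ((deriv ^^ 1) (G 0) 0) \<le> fact 1 * (sqrt (2 * R) * exp C) / R ^ 1"
      proof (rule Cauchy_inequality)
        show "G 0 holomorphic_on ball 0 R" using Ghol holomorphic_on_subset by blast
        show "continuous_on (cball 0 R) (G 0)" 
          using Ghol[of 0] holomorphic_on_imp_continuous_on holomorphic_on_subset by blast
        show "0 < R" using R by simp
        show "cmod (G 0 x) \<le> sqrt (2 * R) * exp C" if "cmod (0 - x) = R" for x
          using main[OF R, of x] that by simp
      qed
      also have "\<dots> = sqrt 2 * exp C / sqrt R" using R 
        by (simp add: real_sqrt_mult field_simps) 
      finally show ?thesis by simp
    qed
    then have "eventually (\<lambda>R. cmod (deriv (G 0) 0) \<le> sqrt 2 * exp C / sqrt R) at_top"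
      by (intro eventually_mono[OF eventually_ge_at_top[of 1]])
    moreover have "((\<lambda>R. sqrt 2 * exp C / sqrt R) \<longlongrightarrow> 0) at_top" by real_asymp
    ultimately have "cmod (deriv (G 0) 0) \<le> 0"
      by (intro tendsto_lowerbound[where F = at_top and f = "\<lambda>R. sqrt 2 * exp C / sqrt R"]) auto
    then have "(G 0 has_field_derivative 0) (at 0)" using der by simp
    moreover have "G 0 = (\<lambda>t. diag_deriv f (z + t *s ones))" by (simp add: G_def fun_eq_iff)
    ultimately show ?thesis by simp
  qed
  \<comment> \<open>The right-hand side of \<open>f (y + c) = 1 - (D f (y))\<^sup>n\<close> has derivative \<open>0\<close>, the left-hand side \<open>D f (y + c)\<close>.\<close>
  have D0: "diag_deriv f z = 0" for z
  proof -
    define y where "y = z - c"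
    have 1: "((\<lambda>t. f (z + t *s ones)) has_field_derivative diag_deriv f z) (at 0)"
      using diag_deriv_line[OF f, of z 0] by simp
    have "((\<lambda>t. 1 - diag_deriv f (y + t *s ones) ^ n) has_field_derivative 0) (at 0)"
      by (rule derivative_eq_intros DG0 refl | simp)+
    moreover have "1 - diag_deriv f (y + t *s ones) ^ n = f (z + t *s ones)" for t
      using eq[of "y + t *s ones"] by (simp add: y_def algebra_simps)
    ultimately show ?thesis using 1 DERIV_unique by simp
  qed
  show "f z = 1" using eq[of "z - c"] D0 n by (simp add: power_0_left)
qed

section \<open>Alternating forms on a symplectic frame\<close>

definition alternation :: "nat \<Rightarrow> 'v form \<Rightarrow> 'v form" where
  "alternation n F v = (\<Sum>\<pi> | \<pi> permutes {..<n}. of_int (sign \<pi>) * F (\<lambda>i. v (\<pi> i)))"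

lemma sign_compose_permutes:
  assumes "p permutes {..<n}" "q permutes {..<n::nat}"
  shows "sign (p \<circ> q) = sign p * sign q"
  using assms by (auto intro!: sign_compose simp: permutation_permutes)

lemma alternation_precompose:
  assumes q: "q permutes {..<n}"
  shows "alternation n (\<lambda>v. F (\<lambda>i. v (q i))) v = of_int (sign q) * alternation n F v"
proof -
  have "of_int (sign q) * alternation n F v
      = of_int (sign q) * (\<Sum>\<pi> | \<pi> permutes {..<n}. of_int (sign (\<pi> \<circ> q)) * F (\<lambda>i. v ((\<pi> \<circ> q) i)))"
    unfolding alternation_def by (subst sum_permutations_compose_right[OF q]) simp
  also have "\<dots> = (\<Sum>\<pi> | \<pi> permutes {..<n}. of_int (sign \<pi>) * F (\<lambda>i. v (\<pi> (q i))))"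
    unfolding sum_distrib_left
  proof (intro sum.cong refl)
    fix \<pi> assume "\<pi> \<in> {\<pi>. \<pi> permutes {..<n}}"
    then have "sign (\<pi> \<circ> q) = sign \<pi> * sign q" using q by (simp add: sign_compose_permutes)
    moreover have "sign q * (sign \<pi> * sign q) = sign \<pi>"
      by (metis mult.left_commute mult.right_neutral sign_idempotent)
    ultimately have "of_int (sign q) * of_int (sign (\<pi> \<circ> q)) = (of_int (sign \<pi>) :: complex)"
      by (metis of_int_mult)
    then show "of_int (sign q) * (of_int (sign (\<pi> \<circ> q)) * F (\<lambda>i. v ((\<pi> \<circ> q) i))) =
        of_int (sign \<pi>) * F (\<lambda>i. v (\<pi> (q i)))"
      by (simp add: mult.assoc[symmetric])
  qed
  finally show ?thesis by (simp add: alternation_def)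
qed

text \<open>
  Composition with a transposition changes the sign of an alternation, so the alternation of a form
  that is symmetric in two of its slots is its own negative.
\<close>

lemma alternation_eq_0:
  assumes "i < n" "j < n" "i \<noteq> j" and F: "\<And>v. F (\<lambda>t. v (Transposition.transpose i j t)) = F v"
  shows "alternation n F v = 0"
proof -
  have "Transposition.transpose i j permutes {..<n}" using assms by (intro permutes_swap_id) auto
  from alternation_precompose[OF this, of F v] show ?thesis
    using assms by (simp add: sign_swap_id)
qed

lemma alternation_diff: "alternation n (\<lambda>v. F v - G v) v = alternation n F v - alternation n G v"
  by (simp add: alternation_def algebra_simps sum_subtractf)

lemma alternation_cmult: "alternation n (\<lambda>v. c * F v) v = c * alternation n F v"
  by (simp add: alternation_def sum_distrib_left mult_ac)

text \<open>
  Associativity of the wedge product in the form needed below: alternating the last \<open>q\<close> slots first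
  and then all of them is, up to the factor \<open>q!\<close>, alternating all of them once. Each permutation
  \<open>\<sigma>\<close> of the last slots can be absorbed into the outer sum, its sign being absorbed as well.
\<close>

lemma wedge_alternation:
  assumes \<alpha>: "\<And>v v'. (\<And>i. i < p \<Longrightarrow> v i = v' i) \<Longrightarrow> \<alpha> v = \<alpha> v'"
  shows "wedge p q \<alpha> (\<lambda>v. c * alternation q B v) v
    = c / fact p * alternation (p + q) (\<lambda>v. \<alpha> v * B (\<lambda>i. v (p + i))) v"
proof -
  let ?H = "\<lambda>v. \<alpha> v * B (\<lambda>i. v (p + i))"
  let ?P = "\<lambda>n::nat. {\<pi>. \<pi> permutes {..<n}}"
  have key: "(\<Sum>\<pi>\<in>?P (p + q). of_int (sign \<pi>) * (of_int (sign \<sigma>) * (\<alpha> (\<lambda>i. v (\<pi> i)) * B (\<lambda>i. v (\<pi> (p + \<sigma> i))))))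
      = alternation (p + q) ?H v" (is "?L = _") if \<sigma>: "\<sigma> permutes {..<q}" for \<sigma>
  proof -
    \<comment> \<open>\<open>s\<close> acts like \<open>\<sigma>\<close> on the last \<open>q\<close> slots and fixes the first \<open>p\<close>, the only ones that \<open>\<alpha>\<close> sees.\<close>
    define s where "s = map_permutation {..<q} ((+) p) \<sigma>"
    have bij: "bij_betw ((+) p) {..<q} {p..<p + q}"
      by (simp add: bij_betw_def lessThan_atLeast0 add.commute)
    have "s permutes {p..<p + q}"
      unfolding s_def by (rule map_permutation_permutes[OF bij \<sigma>])
    then have s: "s permutes {..<p + q}" by (rule permutes_subset) auto
    have sgn: "sign s = sign \<sigma>" unfolding s_def using \<sigma> by (intro sign_map_permutation) auto
    have s1: "s i = i" if "i < p" for i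
      using \<open>s permutes {p..<p + q}\<close> that by (auto simp: permutes_def)
    have s2: "s (p + i) = p + \<sigma> i" for i
    proof (cases "i < q")
      case True
      then have "p + i \<in> (+) p ` {..<q}" by simp
      moreover have "inv_into {..<q} ((+) p) (p + i) = i"
        using True by (intro inv_into_f_eq) auto
      ultimately show ?thesis unfolding s_def map_permutation_def by simp
    next
      case False
      then have "\<sigma> i = i" using \<sigma> by (auto simp: permutes_def)
      moreover have "s (p + i) = p + i" using s False by (auto simp: permutes_def)
      ultimately show ?thesis by simp
    qed
    have "alternation (p + q) (\<lambda>v. ?H (\<lambda>i. v (s i))) v = of_int (sign \<sigma>) * alternation (p + q) ?H v"
      using alternation_precompose[OF s, of ?H v] sgn by simp
    moreover have "alternation (p + q) (\<lambda>v. ?H (\<lambda>i. v (s i))) v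
        = (\<Sum>\<pi>\<in>?P (p + q). of_int (sign \<pi>) * (\<alpha> (\<lambda>i. v (\<pi> i)) * B (\<lambda>i. v (\<pi> (p + \<sigma> i)))))"
      unfolding alternation_def s2 by (intro sum.cong refl arg_cong2[of _ _ _ _ "(*)"] \<alpha>) (auto simp: s1)
    moreover have "?L = of_int (sign \<sigma>) * (\<Sum>\<pi>\<in>?P (p + q). of_int (sign \<pi>) * (\<alpha> (\<lambda>i. v (\<pi> i)) * B (\<lambda>i. v (\<pi> (p + \<sigma> i)))))"
      by (simp add: sum_distrib_left mult_ac)
    moreover have "of_int (sign \<sigma>) * (of_int (sign \<sigma>) * x) = x" for x :: complex
      by (simp add: sign_def)
    ultimately show ?thesis by simp
  qed
  have "(\<Sum>\<pi>\<in>?P (p + q). of_int (sign \<pi>) * \<alpha> (\<lambda>i. v (\<pi> i)) * (c * alternation q B (\<lambda>i. v (\<pi> (p + i)))))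
      = c * (\<Sum>\<pi>\<in>?P (p + q). \<Sum>\<sigma>\<in>?P q. of_int (sign \<pi>) * (of_int (sign \<sigma>) * (\<alpha> (\<lambda>i. v (\<pi> i)) * B (\<lambda>i. v (\<pi> (p + \<sigma> i))))))"
    by (simp add: alternation_def sum_distrib_left mult_ac)
  also have "\<dots> = c * (\<Sum>\<sigma>\<in>?P q. alternation (p + q) ?H v)"
    by (subst sum.swap) (simp add: key)
  also have "\<dots> = c * (fact q * alternation (p + q) ?H v)"
    using card_permutations[of "{..<q}" q] by simp
  finally show ?thesis unfolding wedge_def by simp
qed

lemma wedge_power2_alternation:
  "wedge_power2 k (\<lambda>v. w (v 0) (v 1)) v
    = 1 / 2 ^ k * alternation (2 * k) (\<lambda>v. \<Prod>j<k. w (v (2 * j)) (v (2 * j + 1))) v"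
proof (induction k arbitrary: v)
  case 0
  have "{\<pi>. \<pi> permutes {..<0::nat}} = {id}" by (auto simp: permutes_def)
  then show ?case by (simp add: alternation_def)
next
  case (Suc k)
  have "wedge_power2 (Suc k) (\<lambda>v. w (v 0) (v 1)) v
      = wedge 2 (2 * k) (\<lambda>v. w (v 0) (v 1)) (\<lambda>v. 1 / 2 ^ k * alternation (2 * k) (\<lambda>v. \<Prod>j<k. w (v (2 * j)) (v (2 * j + 1))) v) v"
    unfolding wedge_power2.simps Suc.IH[abs_def] ..
  also have "\<dots> = 1 / 2 ^ k / fact 2 * alternation (2 + 2 * k)
      (\<lambda>v. w (v 0) (v 1) * (\<Prod>j<k. w (v (2 + 2 * j)) (v (2 + (2 * j + 1))))) v"
    by (subst wedge_alternation) auto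
  also have "\<dots> = 1 / 2 ^ Suc k * alternation (2 * Suc k)
      (\<lambda>v. \<Prod>j<Suc k. w (v (2 * j)) (v (2 * j + 1))) v"
    unfolding prod.lessThan_Suc_shift by (simp add: numeral_2_eq_2)
  finally show ?case .
qed

lemma nested_wedge_alternation:
  "wedge 1 (2 * k + 1) (\<lambda>v. a (v 0)) (wedge 1 (2 * k) (\<lambda>v. b (v 0)) (wedge_power2 k (\<lambda>v. w (v 0) (v 1)))) v
    = 1 / 2 ^ k * alternation (2 * Suc k)
        (\<lambda>v. a (v 0) * (b (v 1) * (\<Prod>j<k. w (v (2 * Suc j)) (v (2 * Suc j + 1))))) v"
proof -
  have 1: "wedge 1 (2 * k) (\<lambda>v. b (v 0)) (wedge_power2 k (\<lambda>v. w (v 0) (v 1)))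
      = (\<lambda>v. 1 / 2 ^ k * alternation (2 * k + 1) (\<lambda>v. b (v 0) * (\<Prod>j<k. w (v (1 + 2 * j)) (v (1 + (2 * j + 1))))) v)"
    unfolding wedge_power2_alternation[abs_def] by (rule ext, subst wedge_alternation) (auto simp: add.commute)
  show ?thesis unfolding 1 by (subst wedge_alternation) auto
qed

lemma wedge_pullback:
  "wedge p q \<alpha> \<beta> (\<lambda>i. L (v i)) = wedge p q (\<lambda>v. \<alpha> (\<lambda>i. L (v i))) (\<lambda>v. \<beta> (\<lambda>i. L (v i))) v"
  by (simp add: wedge_def)

lemma wedge_power2_pullback:
  "wedge_power2 k \<omega> (\<lambda>i. L (v i)) = wedge_power2 k (\<lambda>v. \<omega> (\<lambda>i. L (v i))) v"
  by (induction k arbitrary: v) (simp_all add: wedge_def)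

text \<open>
  The identity \<open>a \<and> b \<and> (h + e a \<and> b)\<^sup>k = a \<and> b \<and> h\<^sup>k\<close>. The factors \<open>w\<close> are replaced by \<open>h\<close> one after
  the other; each difference contains \<open>a\<close> in two slots and so has alternation \<open>0\<close>.
\<close>

lemma alternation_modify_factor:
  fixes a b :: "'v \<Rightarrow> complex"
  assumes w: "\<And>x y. w x y = h x y + e * (a x * b y - a y * b x)"
  shows "alternation (2 * Suc k) (\<lambda>v. a (v 0) * (b (v 1) * (\<Prod>j<k. w (v (2 * Suc j)) (v (2 * Suc j + 1))))) v
    = alternation (2 * Suc k) (\<lambda>v. a (v 0) * (b (v 1) * (\<Prod>j<k. h (v (2 * Suc j)) (v (2 * Suc j + 1))))) v"
proof -
  \<comment> \<open>\<open>g l\<close> lists the factors after the first \<open>l\<close> of them have been replaced.\<close>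
  define g where "g l j = (if j < l then h else w)" for l j :: nat
  define F where "F l v = a (v 0) * (b (v 1) * (\<Prod>j<k. g l j (v (2 * Suc j)) (v (2 * Suc j + 1))))"
    for l and v :: "nat \<Rightarrow> 'v"
  have step: "alternation (2 * Suc k) (F l) v = alternation (2 * Suc k) (F (Suc l)) v" if l: "l < k" for l
  proof -
    define R where "R v = (\<Prod>j\<in>{..<k} - {l}. g l j (v (2 * Suc j)) (v (2 * Suc j + 1)))" for v
    have R': "R v = (\<Prod>j\<in>{..<k} - {l}. g (Suc l) j (v (2 * Suc j)) (v (2 * Suc j + 1)))" for v
      unfolding R_def by (intro prod.cong refl) (auto simp: g_def)
    have F1: "F l v = a (v 0) * (b (v 1) * (w (v (2 * Suc l)) (v (2 * Suc l + 1)) * R v))" for v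
      unfolding F_def R_def using l by (subst prod.remove[of _ l]) (auto simp: g_def)
    have F2: "F (Suc l) v = a (v 0) * (b (v 1) * (h (v (2 * Suc l)) (v (2 * Suc l + 1)) * R v))" for v
      unfolding F_def R' using l by (subst prod.remove[of _ l]) (auto simp: g_def)
    define X where "X v = a (v 0) * (b (v 1) * (a (v (2 * Suc l)) * b (v (2 * Suc l + 1)) * R v))" for v
    define Y where "Y v = a (v 0) * (b (v 1) * (a (v (2 * Suc l + 1)) * b (v (2 * Suc l)) * R v))" for v
    have "F l v - F (Suc l) v = e * (X v - Y v)" for v
      unfolding F1 F2 X_def Y_def w by (simp add: algebra_simps)
    then have "alternation (2 * Suc k) (F l) v - alternation (2 * Suc k) (F (Suc l)) v
        = e * (alternation (2 * Suc k) X v - alternation (2 * Suc k) Y v)"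
      by (simp only: alternation_diff[symmetric] alternation_cmult[symmetric])
    moreover have Rt: "R (\<lambda>t. v (Transposition.transpose 0 i t)) = R v" if i: "i = 2 * Suc l \<or> i = 2 * Suc l + 1" for v i
      unfolding R_def
    proof (intro prod.cong refl)
      fix j assume "j \<in> {..<k} - {l}"
      then have "j \<noteq> l" by simp
      then have "2 * Suc j \<noteq> i \<and> 2 * Suc j + 1 \<noteq> i" using i by presburger
      then show "g l j (v (Transposition.transpose 0 i (2 * Suc j))) (v (Transposition.transpose 0 i (2 * Suc j + 1)))
          = g l j (v (2 * Suc j)) (v (2 * Suc j + 1))"
        by (simp add: Transposition.transpose_def)
    qed
    have "alternation (2 * Suc k) X v = 0"
    proof (rule alternation_eq_0[of 0 _ "2 * Suc l"])
      let ?t = "Transposition.transpose 0 (2 * Suc l)"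
      have "?t 0 = 2 * Suc l" "?t 1 = 1" "?t (2 * Suc l) = 0" "?t (2 * Suc l + 1) = 2 * Suc l + 1"
        by (simp_all add: Transposition.transpose_def)
      then show "X (\<lambda>t. v (?t t)) = X v" for v
        by (simp only: X_def Rt[OF disjI1[OF refl]]) (simp only: mult_ac)
    qed (use l in auto)
    moreover have "alternation (2 * Suc k) Y v = 0"
    proof (rule alternation_eq_0[of 0 _ "2 * Suc l + 1"])
      let ?t = "Transposition.transpose 0 (2 * Suc l + 1)"
      have "?t 0 = 2 * Suc l + 1" "?t 1 = 1" "?t (2 * Suc l + 1) = 0" "?t (2 * Suc l) = 2 * Suc l"
        by (simp_all add: Transposition.transpose_def)
      then show "Y (\<lambda>t. v (?t t)) = Y v" for v
        by (simp only: Y_def Rt[OF disjI2[OF refl]]) (simp only: mult_ac)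
    qed (use l in auto)
    ultimately show ?thesis by simp
  qed
  have "alternation (2 * Suc k) (F 0) v = alternation (2 * Suc k) (F l) v" if "l \<le> k" for l
    using that
  proof (induction l)
    case (Suc l)
    then show ?case using step[of l] by simp
  qed simp
  from this[of k] have "alternation (2 * Suc k) (F 0) v = alternation (2 * Suc k) (F k) v" by simp
  moreover have "F 0 = (\<lambda>v. a (v 0) * (b (v 1) * (\<Prod>j<k. w (v (2 * Suc j)) (v (2 * Suc j + 1)))))"
    by (simp add: F_def fun_eq_iff g_def)
  moreover have "F k = (\<lambda>v. a (v 0) * (b (v 1) * (\<Prod>j<k. h (v (2 * Suc j)) (v (2 * Suc j + 1)))))"
    by (simp add: F_def fun_eq_iff g_def)
  ultimately show ?thesis by simp
qed

text \<open>
  The values of the standard symplectic form on the symplectic basis whose \<open>l\<close>-th pair consists of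
  the vectors numbered \<open>2 l\<close> and \<open>2 l + 1\<close>.
\<close>

definition pairing :: "nat \<Rightarrow> nat \<Rightarrow> int" where
  "pairing i j = (if even i \<and> j = Suc i then 1 else if even j \<and> i = Suc j then - 1 else 0)"

lemma pairing_commute: "pairing j i = - pairing i j"
  by (auto simp: pairing_def)

lemma pairing_nonzeroD:
  assumes "pairing i j \<noteq> 0"
  shows "i div 2 = j div 2"
  using assms by (auto simp: pairing_def split: if_splits elim!: evenE)

text \<open>
  A permutation of the pairs \<open>{2 j, 2 j + 1}\<close> is even: it acts on the even and on the odd numbers by
  two copies of the same permutation, whose signs cancel.
\<close>

lemma block_permutation:
  assumes \<tau>: "\<tau> permutes {..<m::nat}"
  obtains \<pi> where "\<pi> permutes {..<2 * m}" "sign \<pi> = 1"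
    "\<And>j. j < m \<Longrightarrow> \<pi> (2 * j) = 2 * \<tau> j" "\<And>j. j < m \<Longrightarrow> \<pi> (2 * j + 1) = 2 * \<tau> j + 1"
proof -
  define p where "p c = map_permutation {..<m} (\<lambda>j. 2 * j + c) \<tau>" for c :: nat
  have inj: "inj_on (\<lambda>j. 2 * j + c) {..<m}" for c :: nat by (auto intro: inj_onI)
  have perm: "p c permutes (\<lambda>j. 2 * j + c) ` {..<m}" for c
    unfolding p_def by (intro map_permutation_permutes \<tau> inj_on_imp_bij_betw inj)
  have perm': "p c permutes {..<2 * m}" if "c < 2" for c
    by (rule permutes_subset[OF perm]) (use that in auto)
  have on: "p c (2 * j + c) = 2 * \<tau> j + c" if "j < m" for c j
  proof -
    have "2 * j + c \<in> (\<lambda>j. 2 * j + c) ` {..<m}" using that by auto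
    moreover have "inv_into {..<m} (\<lambda>j. 2 * j + c) (2 * j + c) = j"
      using that by (intro inv_into_f_eq inj) auto
    ultimately show ?thesis unfolding p_def map_permutation_def by simp
  qed
  have off: "p c i = i" if "i mod 2 \<noteq> c mod 2" for c i
  proof -
    have "i \<notin> (\<lambda>j. 2 * j + c) ` {..<m}" using that by auto
    then show ?thesis using perm permutes_not_in by metis
  qed
  have sgn: "sign (p c) = sign \<tau>" for c
    unfolding p_def by (intro sign_map_permutation inj \<tau>) auto
  show thesis
  proof (rule that[of "p 0 \<circ> p 1"])
    show "p 0 \<circ> p 1 permutes {..<2 * m}" by (intro permutes_compose perm') auto
    show "sign (p 0 \<circ> p 1) = 1"
      by (subst sign_compose_permutes[of _ "2 * m"]) (auto simp: sgn intro!: perm')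
    fix j assume j: "j < m"
    show "(p 0 \<circ> p 1) (2 * j) = 2 * \<tau> j" using on[OF j, of 0] off[of "2 * j" 1] by simp
    have "p 1 (2 * j + 1) = 2 * \<tau> j + 1" using on[OF j, of 1] .
    moreover have "p 0 (2 * \<tau> j + 1) = 2 * \<tau> j + 1" by (rule off) simp
    ultimately show "(p 0 \<circ> p 1) (2 * j + 1) = 2 * \<tau> j + 1" by simp
  qed
qed

text \<open>
  This is the reason why powers of a Kaehler form have a definite sign. If the product does not
  vanish, then \<open>\<pi>\<close> maps pairs to pairs. Swapping the two numbers of a pair changes the sign of both
  factors of the claim, so \<open>\<pi>\<close> may be assumed to respect the order within each pair; then it is
  a permutation of the pairs and even, and all factors of the product are \<open>1\<close>.
\<close>

lemma sign_pairing_nonneg: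
  assumes "\<pi> permutes {..<2 * m}"
  shows "sign \<pi> * (\<Prod>j<m. pairing (\<pi> (2 * j)) (\<pi> (2 * j + 1))) \<ge> 0"
  using assms
proof (induction "card {j. j < m \<and> odd (\<pi> (2 * j))}" arbitrary: \<pi> rule: less_induct)
  case less
  note \<pi> = less.prems
  let ?Q = "\<lambda>\<pi>. \<Prod>j<m. pairing (\<pi> (2 * j)) (\<pi> (2 * j + 1))"
  show ?case
  proof (cases "?Q \<pi> = 0")
    case False
    then have nz: "pairing (\<pi> (2 * j)) (\<pi> (2 * j + 1)) \<noteq> 0" if "j < m" for j
      using that by auto
    show ?thesis
    proof (cases "\<exists>j<m. odd (\<pi> (2 * j))")
      case True
      then obtain l where l: "l < m" "odd (\<pi> (2 * l))" by blast
      define t where "t = Transposition.transpose (2 * l) (2 * l + 1)"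
      have t: "t permutes {..<2 * m}" unfolding t_def using l by (intro permutes_swap_id) auto
      have t1: "t (2 * l) = 2 * l + 1" "t (2 * l + 1) = 2 * l" by (auto simp: t_def)
      have t2: "t (2 * j) = 2 * j" "t (2 * j + 1) = 2 * j + 1" if "j \<noteq> l" for j
        unfolding t_def Transposition.transpose_def using that by presburger+
      have ev: "even (\<pi> (2 * l + 1))" using nz[OF l(1)] l(2) by (auto simp: pairing_def split: if_splits)
      have perm: "\<pi> \<circ> t permutes {..<2 * m}" by (intro permutes_compose t \<pi>)
      have sgn: "sign (\<pi> \<circ> t) = - sign \<pi>"
        using sign_compose_permutes[OF \<pi> t] by (simp add: t_def sign_swap_id)
      have "?Q (\<pi> \<circ> t) = - ?Q \<pi>"
      proof -
        have "?Q (\<pi> \<circ> t) = pairing (\<pi> (2 * l + 1)) (\<pi> (2 * l)) 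
            * (\<Prod>j\<in>{..<m} - {l}. pairing ((\<pi> \<circ> t) (2 * j)) ((\<pi> \<circ> t) (2 * j + 1)))"
          using l by (subst prod.remove[of _ l]) (auto simp: t1[simplified])
        also have "(\<Prod>j\<in>{..<m} - {l}. pairing ((\<pi> \<circ> t) (2 * j)) ((\<pi> \<circ> t) (2 * j + 1)))
            = (\<Prod>j\<in>{..<m} - {l}. pairing (\<pi> (2 * j)) (\<pi> (2 * j + 1)))"
          by (intro prod.cong refl) (metis DiffE comp_apply insertI1 t2)
        also have "pairing (\<pi> (2 * l + 1)) (\<pi> (2 * l)) * \<dots> = - ?Q \<pi>"
          using l by (subst (2) prod.remove[of _ l]) (auto simp: pairing_commute[of _ "\<pi> (2 * l)"])
        finally show ?thesis .
      qed
      moreover have "card {j. j < m \<and> odd ((\<pi> \<circ> t) (2 * j))} < card {j. j < m \<and> odd (\<pi> (2 * j))}"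
      proof (rule psubset_card_mono)
        have "j \<noteq> l \<and> odd (\<pi> (2 * j))" if "odd ((\<pi> \<circ> t) (2 * j))" for j
          using that ev t1 t2[of j] by (cases "j = l") auto
        then show "{j. j < m \<and> odd ((\<pi> \<circ> t) (2 * j))} \<subset> {j. j < m \<and> odd (\<pi> (2 * j))}"
          using l by blast
      qed auto
      then have "sign (\<pi> \<circ> t) * ?Q (\<pi> \<circ> t) \<ge> 0" using less.hyps perm by blast
      ultimately show ?thesis using sgn by simp
    next
      case False
      define \<tau> where "\<tau> j = (if j < m then \<pi> (2 * j) div 2 else j)" for j
      have e1: "\<pi> (2 * j) = 2 * \<tau> j" "\<pi> (2 * j + 1) = 2 * \<tau> j + 1" if "j < m" for j
      proof -
        show e: "\<pi> (2 * j) = 2 * \<tau> j" using False that by (auto simp: \<tau>_def)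
        show "\<pi> (2 * j + 1) = 2 * \<tau> j + 1"
          using nz[OF that] e False that by (auto simp: pairing_def split: if_splits)
      qed
      have \<tau>: "\<tau> permutes {..<m}"
      proof (rule bij_imp_permutes)
        have "inj_on \<tau> {..<m}"
        proof (rule inj_onI)
          fix i j assume "i \<in> {..<m}" "j \<in> {..<m}" "\<tau> i = \<tau> j"
          then have "\<pi> (2 * i) = \<pi> (2 * j)" using e1 by simp
          then have "2 * i = 2 * j" by (rule injD[OF permutes_inj[OF \<pi>]])
          then show "i = j" by simp
        qed
        moreover have "\<tau> ` {..<m} \<subseteq> {..<m}"
        proof
          fix y assume "y \<in> \<tau> ` {..<m}"
          then obtain j where j: "j < m" "y = \<tau> j" by auto
          have "\<pi> (2 * j) \<in> {..<2 * m}" using \<pi> j by (simp only: permutes_in_image) simp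
          then show "y \<in> {..<m}" using e1[OF j(1)] j by simp
        qed
        ultimately show "bij_betw \<tau> {..<m} {..<m}"
          by (simp add: bij_betw_def endo_inj_surj)
      qed (auto simp: \<tau>_def)
      obtain \<rho> where \<rho>: "\<rho> permutes {..<2 * m}" "sign \<rho> = 1"
        "\<And>j. j < m \<Longrightarrow> \<rho> (2 * j) = 2 * \<tau> j" "\<And>j. j < m \<Longrightarrow> \<rho> (2 * j + 1) = 2 * \<tau> j + 1"
        by (rule block_permutation[OF \<tau>]) (rule that)
      have "\<pi> i = \<rho> i" for i
      proof (cases "i < 2 * m")
        case True
        define j where "j = i div 2"
        have j: "j < m" using True by (simp add: j_def)
        have "i = 2 * j \<or> i = 2 * j + 1" unfolding j_def by presburger
        then show ?thesis using e1[OF j] \<rho>(3,4)[OF j] by (elim disjE) simp_all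
      next
        case False
        then show ?thesis using \<pi> \<rho>(1) by (simp add: permutes_not_in)
      qed
      then have "\<pi> = \<rho>" by (rule ext)
      then have "sign \<pi> = 1" using \<rho>(2) by simp
      moreover have "?Q \<pi> = 1"
        by (intro prod.neutral ballI) (use e1 in \<open>auto simp: pairing_def\<close>)
      ultimately show ?thesis by simp
    qed
  qed (simp only: mult_zero_right order_refl)
qed

text \<open>
  The images of the numbers \<open>2, \<dots>, 2 k + 1\<close> form full pairs, so the number paired with \<open>\<pi> 0\<close> is not among
  them and can only be \<open>\<pi> 1\<close>.
\<close>

lemma last_pair_is_block:
  assumes \<pi>: "\<pi> permutes {..<2 * Suc k}"
    and nz: "\<And>j. j < k \<Longrightarrow> pairing (\<pi> (2 * Suc j)) (\<pi> (2 * Suc j + 1)) \<noteq> 0"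
  shows "\<pi> 0 div 2 = \<pi> 1 div 2"
proof -
  \<comment> \<open>\<open>pt\<close> exchanges the two members of each pair.\<close>
  define pt where "pt i = (if even i then i + 1 else i - 1)" for i :: nat
  have pt_pt: "pt (pt i) = i" for i by (auto simp: pt_def elim: oddE)
  have pt_ne: "pt i \<noteq> i" for i by (auto simp: pt_def elim: oddE)
  have pt_div: "pt i div 2 = i div 2" for i by (auto simp: pt_def elim!: oddE)
  have pt_pair: "y = pt x" if "pairing x y \<noteq> 0" for x y
    using that by (auto simp: pt_def pairing_def split: if_splits)
  have "\<pi> 0 \<in> {..<2 * Suc k}" using \<pi> by (simp only: permutes_in_image) simp
  then have "pt (\<pi> 0) \<in> {..<2 * Suc k}" using pt_div[of "\<pi> 0"] unfolding lessThan_iff by presburger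
  then obtain i where i: "i < 2 * Suc k" "\<pi> i = pt (\<pi> 0)"
    using permutes_image[OF \<pi>] by (metis imageE lessThan_iff)
  have "i \<noteq> 0" using i pt_ne by metis
  have "i = 1"
  proof (rule ccontr)
    assume "i \<noteq> 1"
    define j where "j = i div 2 - 1"
    have j: "j < k" "i = 2 * Suc j \<or> i = 2 * Suc j + 1"
      using \<open>i \<noteq> 0\<close> \<open>i \<noteq> 1\<close> i(1) unfolding j_def by presburger+
    have "\<pi> (pt i) = pt (\<pi> i)"
    proof (cases "i = 2 * Suc j")
      case True
      with pt_pair[OF nz[OF j(1)]] show ?thesis by (simp add: pt_def)
    next
      case False
      then have i': "i = 2 * Suc j + 1" using j by simp
      with pt_pair[OF nz[OF j(1)]] have "\<pi> i = pt (\<pi> (pt i))" by (simp add: pt_def)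
      then show ?thesis using pt_pt by metis
    qed
    then have "\<pi> (pt i) = \<pi> 0" using i pt_pt by simp
    then have "pt i = 0" by (rule injD[OF permutes_inj[OF \<pi>]])
    then have "i = 1" using pt_pt[of i] by (simp add: pt_def)
    with \<open>i \<noteq> 1\<close> show False by simp
  qed
  then show ?thesis using i pt_div by metis
qed

definition block_coeff :: "nat \<Rightarrow> (nat \<Rightarrow> nat) \<Rightarrow> int" where
  "block_coeff m \<pi> = sign \<pi> * (\<Prod>j<m. pairing (\<pi> (2 * j)) (\<pi> (2 * j + 1)))"

text \<open>
  Symmetrising \<open>a (\<pi> 0) * b (\<pi> 1)\<close> over the swap of the first two slots turns it into half of a
  \<open>2 \<times> 2\<close> minor, which completes the product of the \<open>k\<close> pairings to the product over all pairs.
\<close>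

lemma alternation_block:
  fixes a b q :: "nat \<Rightarrow> complex" and \<kappa> :: complex
  assumes ab: "\<And>i j. i < 2 * Suc k \<Longrightarrow> j < 2 * Suc k \<Longrightarrow> i div 2 = j div 2 \<Longrightarrow>
      a i * b j - a j * b i = of_int (pairing i j) * q (i div 2)"
  shows "2 * (\<Sum>\<pi> | \<pi> permutes {..<2 * Suc k}. of_int (sign \<pi>) *
      (a (\<pi> 0) * (b (\<pi> 1) * (\<Prod>j<k. \<kappa> * of_int (pairing (\<pi> (2 * Suc j)) (\<pi> (2 * Suc j + 1)))))))
    = \<kappa> ^ k * (\<Sum>\<pi> | \<pi> permutes {..<2 * Suc k}. of_int (block_coeff (Suc k) \<pi>) * q (\<pi> 0 div 2))"
proof -
  let ?P = "{\<pi>. \<pi> permutes {..<2 * Suc k}}"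
  define R where "R \<pi> = (\<Prod>j<k. pairing (\<pi> (2 * Suc j)) (\<pi> (2 * Suc j + 1)))" for \<pi>
  have R: "(\<Prod>j<k. \<kappa> * of_int (pairing (\<pi> (2 * Suc j)) (\<pi> (2 * Suc j + 1)))) = \<kappa> ^ k * of_int (R \<pi>)" for \<pi>
    by (simp add: R_def prod.distrib)
  define t where "t = Transposition.transpose 0 (1::nat)"
  have t: "t permutes {..<2 * Suc k}" unfolding t_def by (intro permutes_swap_id) auto
  define S where "S = (\<Sum>\<pi>\<in>?P. of_int (sign \<pi>) * (a (\<pi> 0) * (b (\<pi> 1) * (\<kappa> ^ k * of_int (R \<pi>)))))"
  have "S = (\<Sum>\<pi>\<in>?P. of_int (sign (\<pi> \<circ> t)) * (a ((\<pi> \<circ> t) 0) * (b ((\<pi> \<circ> t) 1) * (\<kappa> ^ k * of_int (R (\<pi> \<circ> t))))))"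
    unfolding S_def by (rule sum_permutations_compose_right[OF t])
  also have "\<dots> = (\<Sum>\<pi>\<in>?P. - of_int (sign \<pi>) * (a (\<pi> 1) * (b (\<pi> 0) * (\<kappa> ^ k * of_int (R \<pi>)))))"
  proof (intro sum.cong refl)
    fix \<pi> assume "\<pi> \<in> ?P"
    then have "sign (\<pi> \<circ> t) = - sign \<pi>"
      using sign_compose_permutes[OF _ t, of \<pi>] by (simp add: t_def sign_swap_id)
    moreover have "R (\<pi> \<circ> t) = R \<pi>"
      by (simp add: R_def t_def Transposition.transpose_def)
    moreover have "t 0 = 1" "t 1 = 0" by (simp_all add: t_def)
    ultimately show "of_int (sign (\<pi> \<circ> t)) * (a ((\<pi> \<circ> t) 0) * (b ((\<pi> \<circ> t) 1) * (\<kappa> ^ k * of_int (R (\<pi> \<circ> t)))))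
        = - of_int (sign \<pi>) * (a (\<pi> 1) * (b (\<pi> 0) * (\<kappa> ^ k * of_int (R \<pi>))))" by simp
  qed
  finally have S': "S = (\<Sum>\<pi>\<in>?P. - of_int (sign \<pi>) * (a (\<pi> 1) * (b (\<pi> 0) * (\<kappa> ^ k * of_int (R \<pi>)))))" .
  have "2 * S = S + S" by simp
  also have "\<dots> = (\<Sum>\<pi>\<in>?P. of_int (sign \<pi>) * (a (\<pi> 0) * (b (\<pi> 1) * (\<kappa> ^ k * of_int (R \<pi>)))))
      + (\<Sum>\<pi>\<in>?P. - of_int (sign \<pi>) * (a (\<pi> 1) * (b (\<pi> 0) * (\<kappa> ^ k * of_int (R \<pi>)))))"
    by (rule arg_cong2[of _ _ _ _ "(+)", OF S_def S'])
  also have "\<dots> = (\<Sum>\<pi>\<in>?P. \<kappa> ^ k * (of_int (sign \<pi> * R \<pi>) * (a (\<pi> 0) * b (\<pi> 1) - a (\<pi> 1) * b (\<pi> 0))))"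
    unfolding sum.distrib[symmetric] by (intro sum.cong refl) (simp add: algebra_simps)
  also have "\<dots> = (\<Sum>\<pi>\<in>?P. \<kappa> ^ k * (of_int (block_coeff (Suc k) \<pi>) * q (\<pi> 0 div 2)))"
  proof (intro sum.cong refl arg_cong[where f = "\<lambda>x. \<kappa> ^ k * x"])
    fix \<pi> assume "\<pi> \<in> ?P"
    then have \<pi>: "\<pi> permutes {..<2 * Suc k}" by simp
    have c: "block_coeff (Suc k) \<pi> = sign \<pi> * (pairing (\<pi> 0) (\<pi> 1) * R \<pi>)"
      unfolding block_coeff_def R_def prod.lessThan_Suc_shift by simp
    show "of_int (sign \<pi> * R \<pi>) * (a (\<pi> 0) * b (\<pi> 1) - a (\<pi> 1) * b (\<pi> 0))
        = of_int (block_coeff (Suc k) \<pi>) * q (\<pi> 0 div 2)"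
    proof (cases "R \<pi> = 0")
      case False
      then have nz: "pairing (\<pi> (2 * Suc j)) (\<pi> (2 * Suc j + 1)) \<noteq> 0" if "j < k" for j
        using that unfolding R_def by auto
      have "\<pi> 0 \<in> {..<2 * Suc k}" "\<pi> 1 \<in> {..<2 * Suc k}"
        using \<pi> by (simp_all only: permutes_in_image) simp_all
      then have "a (\<pi> 0) * b (\<pi> 1) - a (\<pi> 1) * b (\<pi> 0) = of_int (pairing (\<pi> 0) (\<pi> 1)) * q (\<pi> 0 div 2)"
        using ab last_pair_is_block[OF \<pi> nz] by simp
      then show ?thesis by (simp add: c)
    qed (simp add: c)
  qed
  finally show ?thesis unfolding R S_def by (simp add: sum_distrib_left)
qed

text \<open>
  All coefficients are nonnegative, and for each \<open>l\<close> the permutation that exchanges the pairs \<open>0\<close> and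
  \<open>l\<close> contributes \<open>q l\<close> with coefficient \<open>1\<close>.
\<close>

lemma block_coeff_sum_ge:
  fixes q :: "nat \<Rightarrow> real"
  assumes q: "\<And>l. l < m \<Longrightarrow> q l \<ge> 0" and m: "m > 0"
  shows "(\<Sum>l<m. q l) \<le> (\<Sum>\<pi> | \<pi> permutes {..<2 * m}. of_int (block_coeff m \<pi>) * q (\<pi> 0 div 2))"
proof -
  have "\<exists>\<pi>. \<pi> permutes {..<2 * m} \<and> \<pi> 0 = 2 * l \<and> block_coeff m \<pi> = 1" if "l < m" for l
  proof -
    have "Transposition.transpose 0 l permutes {..<m}" using that by (intro permutes_swap_id) auto
    then obtain \<pi> where \<pi>: "\<pi> permutes {..<2 * m}" "sign \<pi> = 1"
      "\<And>j. j < m \<Longrightarrow> \<pi> (2 * j) = 2 * Transposition.transpose 0 l j"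
      "\<And>j. j < m \<Longrightarrow> \<pi> (2 * j + 1) = 2 * Transposition.transpose 0 l j + 1"
      using block_permutation by metis
    have "block_coeff m \<pi> = 1" unfolding block_coeff_def using \<pi> by (simp add: pairing_def)
    moreover have "\<pi> 0 = 2 * l" using \<pi>(3)[of 0] m by simp
    ultimately show ?thesis using \<pi>(1) by blast
  qed
  then obtain p where p: "\<And>l. l < m \<Longrightarrow> p l permutes {..<2 * m}" "\<And>l. l < m \<Longrightarrow> p l 0 = 2 * l"
      "\<And>l. l < m \<Longrightarrow> block_coeff m (p l) = 1"
    by metis
  let ?g = "\<lambda>\<pi>. of_int (block_coeff m \<pi>) * q (\<pi> 0 div 2)"
  have inj: "inj_on p {..<m}"
    by (rule inj_onI) (metis lessThan_iff mult_left_cancel p(2) zero_neq_numeral)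
  have "(\<Sum>l<m. q l) = (\<Sum>l<m. ?g (p l))" by (intro sum.cong) (simp_all add: p)
  also have "\<dots> = (\<Sum>\<pi>\<in>p ` {..<m}. ?g \<pi>)" by (simp add: sum.reindex[OF inj])
  also have "\<dots> \<le> (\<Sum>\<pi> | \<pi> permutes {..<2 * m}. ?g \<pi>)"
  proof (rule sum_mono2)
    show "finite {\<pi>. \<pi> permutes {..<2 * m}}" by (simp add: finite_permutations)
    show "p ` {..<m} \<subseteq> {\<pi>. \<pi> permutes {..<2 * m}}" using p by auto
    fix \<pi> assume "\<pi> \<in> {\<pi>. \<pi> permutes {..<2 * m}} - p ` {..<m}"
    then have \<pi>: "\<pi> permutes {..<2 * m}" by simp
    then have "\<pi> 0 \<in> {..<2 * m}" using m by (simp only: permutes_in_image) simp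
    then have "\<pi> 0 div 2 < m" by auto
    moreover have "0 \<le> real_of_int (block_coeff m \<pi>)"
      using sign_pairing_nonneg[OF \<pi>] by (simp only: block_coeff_def of_int_0_le_iff)
    ultimately show "0 \<le> ?g \<pi>" using q by simp
  qed
  finally show ?thesis .
qed

section \<open>The density of the Nevanlinna characteristic\<close>

text \<open>
  Complex structure: all forms below are expressed by \<open>J\<close> and the real inner product, where
  \<open>z \<bullet> v\<close> and \<open>- (z \<bullet> J v)\<close> are the real and the imaginary part of the Hermitian product of \<open>v\<close> and \<open>z\<close>.
\<close>

definition J :: "complex^'m \<Rightarrow> complex^'m" where "J v = \<i> *s v"

lemma J_linear: "linear J"
  by (rule linearI) (simp_all add: J_def vec_eq_iff distrib_left)

lemma J_diff: "J (v - w) = J v - J w" and J_scale: "J (c *\<^sub>R v) = c *\<^sub>R J v"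
  by (simp_all only: linear_diff[OF J_linear] linear_scale[OF J_linear])

lemma J_inner_swap: "J v \<bullet> w = - (v \<bullet> J w)"
  unfolding inner_vec_def sum_negf[symmetric]
  by (intro sum.cong refl) (simp add: J_def inner_complex_def)

lemma J_inner_self: "v \<bullet> J v = 0" "J v \<bullet> v = 0"
  using J_inner_swap[of v v] inner_commute[of v "J v"] by linarith+

lemma dc_form_eq:
  assumes "(u has_derivative u') (at z)"
  shows "dc_form u z v = - of_real (u' (J (v 0)) / (4 * pi))"
proof -
  have "frechet_derivative u (at z) = u'" using frechet_derivative_at[OF assms] by simp
  then show ?thesis
    by (simp add: dc_form_def delbar_form_def del_form_def J_def field_simps)
qed

lemma has_derivative_ln_tau:
  fixes z :: "complex^'m"
  assumes "z \<noteq> 0"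
  shows "((\<lambda>z. ln (tau z)) has_derivative (\<lambda>h. 2 * (z \<bullet> h) / (z \<bullet> z))) (at z)"
proof -
  have "z \<bullet> z > 0" using assms by simp
  moreover have "(\<lambda>z::complex^'m. ln (tau z)) = (\<lambda>z. ln (z \<bullet> z))"
    by (simp add: tau_def power2_norm_eq_inner)
  moreover have "((\<lambda>z. ln (z \<bullet> z)) has_derivative (\<lambda>h. 2 * (z \<bullet> h) / (z \<bullet> z))) (at z)"
  proof -
    have "((\<lambda>z. z \<bullet> z) has_derivative (\<lambda>h. z \<bullet> h + h \<bullet> z)) (at z)"
      using bounded_bilinear.FDERIV[OF bounded_bilinear_inner has_derivative_ident[of "at z"] has_derivative_ident[of "at z"]] .
    moreover have "(\<lambda>h. z \<bullet> h + h \<bullet> z) = (\<lambda>h. 2 * (z \<bullet> h))"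
      by (rule ext) (simp add: inner_commute)
    ultimately have "((\<lambda>z. z \<bullet> z) has_derivative (\<lambda>h. 2 * (z \<bullet> h))) (at z)"
      by simp
    from has_derivative_ln[where g = "\<lambda>z. z \<bullet> z", OF \<open>z \<bullet> z > 0\<close> this] show ?thesis
      by (simp add: divide_inverse)
  qed
  ultimately show ?thesis by simp
qed

lemma dc_ln_tau:
  fixes z :: "complex^'m"
  assumes "z \<noteq> 0"
  shows "dc_form (\<lambda>z. ln (tau z)) z v = of_real (- (z \<bullet> J (v 0)) / (2 * pi * (z \<bullet> z)))"
  unfolding dc_form_eq[OF has_derivative_ln_tau[OF assms]] by (simp add: field_simps)

text \<open>
  The Fubini--Study form: the Euclidean symplectic form \<open>J v \<bullet> w\<close>, scaled by \<open>1 / (\<pi> \<bar>z\<bar>\<^sup>2)\<close>, minus its part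
  on the complex line through \<open>z\<close>.
\<close>

lemma omega_form_eq:
  fixes z :: "complex^'m"
  assumes z: "z \<noteq> 0"
  shows "omega_form z v = of_real ((J (v 0) \<bullet> v 1
      + ((z \<bullet> v 0) * (z \<bullet> J (v 1)) - (z \<bullet> v 1) * (z \<bullet> J (v 0))) / (z \<bullet> z)) / (pi * (z \<bullet> z)))"
proof -
  have zz: "z \<bullet> z > 0" using z by simp
  define D where "D w h = - ((h \<bullet> J w) / (z \<bullet> z) - 2 * (z \<bullet> J w) * (z \<bullet> h) / (z \<bullet> z)\<^sup>2) / (2 * pi)" for w h
  have d: "frechet_derivative (\<lambda>y. dc_form (\<lambda>z. ln (tau z)) y (\<lambda>_. w)) (at z) h = of_real (D w h)" for w h
  proof -
    have "((\<lambda>y. - (y \<bullet> J w) / (2 * pi * (y \<bullet> y))) has_derivative D w) (at z)"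
      by (rule derivative_eq_intros refl | use zz in
          \<open>simp add: D_def fun_eq_iff inner_commute power2_eq_square field_simps\<close>)+
    then have "((\<lambda>y. of_real (- (y \<bullet> J w) / (2 * pi * (y \<bullet> y))) :: complex)
        has_derivative (\<lambda>h. of_real (D w h))) (at z)"
      by (rule has_derivative_of_real)
    then have "((\<lambda>y. dc_form (\<lambda>z. ln (tau z)) y (\<lambda>_. w)) has_derivative (\<lambda>h. of_real (D w h))) (at z)"
      by (rule has_derivative_transform_within_open[of _ _ _ _ "- {0}"]) (use z in \<open>auto simp: dc_ln_tau\<close>)
    from frechet_derivative_at[OF this] show ?thesis by metis
  qed
  have "omega_form z v = of_real (D (v 1) (v 0) - D (v 0) (v 1))"
    unfolding omega_form_def ext_deriv1_def d by simp
  also have "D (v 1) (v 0) - D (v 0) (v 1) = (J (v 0) \<bullet> v 1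
      + ((z \<bullet> v 0) * (z \<bullet> J (v 1)) - (z \<bullet> v 1) * (z \<bullet> J (v 0))) / (z \<bullet> z)) / (pi * (z \<bullet> z))"
    using zz J_inner_swap[of "v 0" "v 1"] inner_commute[of "v 1" "J (v 0)"]
    by (simp add: D_def power2_eq_square field_simps)
  finally show ?thesis .
qed

lemma has_derivative_radial_proj:
  fixes x :: "complex^'m"
  assumes "x \<noteq> 0"
  shows "(radial_proj r has_derivative (\<lambda>h. (r / norm x) *\<^sub>R (h - ((x \<bullet> h) / (x \<bullet> x)) *\<^sub>R x))) (at x)"
proof -
  have n: "norm x > 0" using assms by simp
  have nn: "x \<bullet> x = norm x * norm x" by (simp add: dot_square_norm power2_eq_square)
  have dn: "(norm has_derivative (\<lambda>h. h \<bullet> sgn x)) (at x)"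
    using has_derivative_norm[OF assms] by (simp add: inner_commute)
  have s: "h \<bullet> sgn x = (x \<bullet> h) / norm x" for h
    by (simp add: sgn_div_norm inner_commute divide_inverse)
  have "((\<lambda>x. (r / norm x) *\<^sub>R x) has_derivative
      (\<lambda>h. (r / norm x) *\<^sub>R h + (- r * ((x \<bullet> h) / norm x) / (norm x * norm x)) *\<^sub>R x)) (at x)"
    by (rule derivative_eq_intros dn refl | use n in \<open>simp add: s fun_eq_iff field_simps\<close>)+
  moreover have "(r / norm x) *\<^sub>R h + (- r * ((x \<bullet> h) / norm x) / (norm x * norm x)) *\<^sub>R x
      = (r / norm x) *\<^sub>R (h - ((x \<bullet> h) / (x \<bullet> x)) *\<^sub>R x)" for h
    by (simp add: nn scaleR_diff_right)
  ultimately show ?thesis by (simp add: radial_proj_def[abs_def])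
qed

text \<open>
  The density with respect to Lebesgue measure of the top degree form that defines the integral of
  \<open>\<sigma>\<^sub>m\<close> over a sphere of any radius. Since the frame is numbered through an enumeration of the coordinates, the
  value comes as a sum over permutations, which makes its continuity and its positivity visible.
\<close>

definition shell_density :: "complex^'m \<Rightarrow> real" where
  "shell_density x = (1 / (pi * (x \<bullet> x))) ^ (CARD('m) - 1) / 2 ^ CARD('m) *
     (\<Sum>\<pi> | \<pi> permutes {..<2 * CARD('m)}. of_int (block_coeff (CARD('m)) \<pi>) *
        ((cmod (x $ from_nat_into UNIV (\<pi> 0 div 2)))\<^sup>2 / (2 * pi * (x \<bullet> x) * norm x)))"

lemma J_axis: "J (axis p c) = axis p (\<i> * c)"
  by (simp add: J_def vec_eq_iff axis_def)

lemma std_frame_pairing: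
  assumes "i < 2 * CARD('m)" "j < 2 * CARD('m)"
  shows "J (std_frame i) \<bullet> (std_frame j :: complex^'m) = of_int (pairing i j)"
proof -
  have "inj_on (from_nat_into (UNIV::'m set)) {..<CARD('m)}"
    using bij_betw_from_nat_into_finite[of "UNIV::'m set"] by (auto simp: bij_betw_def)
  then have eq: "from_nat_into (UNIV::'m set) (i div 2) = from_nat_into UNIV (j div 2) \<longleftrightarrow> i div 2 = j div 2"
    using assms by (auto dest: inj_onD)
  show ?thesis
  proof (cases "i div 2 = j div 2")
    case True
    then have "j = i \<or> (even i \<and> j = Suc i) \<or> (even j \<and> i = Suc j)" by presburger
    with True show ?thesis
      by (auto simp: std_frame_def J_axis inner_axis_axis pairing_def inner_complex_def)
  next
    case False
    then have "pairing i j = 0" using pairing_nonzeroD by blast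
    with False show ?thesis by (simp add: std_frame_def J_axis inner_axis_axis eq)
  qed
qed

text \<open>
  The minors of the two forms \<open>d\<rho>\<close> and \<open>d\<^sup>c log \<tau>\<close> (up to scaling) on a pair \<open>e, J e\<close> of the frame.
\<close>

lemma std_frame_minor:
  fixes x :: "complex^'m"
  assumes "i div 2 = j div 2"
  shows "(x \<bullet> std_frame j) * (x \<bullet> J (std_frame i)) - (x \<bullet> std_frame i) * (x \<bullet> J (std_frame j))
    = of_int (pairing i j) * (cmod (x $ from_nat_into UNIV (i div 2)))\<^sup>2"
proof -
  define p where "p = from_nat_into (UNIV :: 'm set) (i div 2)"
  have f: "std_frame i = axis p (if even i then 1 else \<i>)" "std_frame j = axis p (if even j then 1 else \<i>)"
    using assms by (simp_all add: std_frame_def p_def)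
  have "j = i \<or> (even i \<and> j = Suc i) \<or> (even j \<and> i = Suc j)" using assms by presburger
  then have "even i \<and> odd j \<and> pairing i j = 1 \<or> odd i \<and> even j \<and> pairing i j = -1
      \<or> (even i \<longleftrightarrow> even j) \<and> pairing i j = 0"
    by (auto simp: pairing_def)
  then show ?thesis
    unfolding f p_def[symmetric] J_axis inner_axis inner_complex_def cmod_power2
    by (elim disjE conjE) (simp_all add: power2_eq_square)
qed

text \<open>
  The forms \<open>d\<^sup>c log \<tau>\<close> and \<open>\<omega>\<close> do not see the radial direction and are invariant under scaling, so
  the pullback under the radial projection is given by the same formulas at \<open>x\<close>. With \<open>a = d\<rho>\<close> and
  \<open>b = d\<^sup>c log \<tau>\<close>, the pullback of \<open>\<omega>\<close> is a multiple of the symplectic form plus a multiple of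
  \<open>a \<and> b\<close>; the latter does not contribute next to \<open>a \<and> b\<close>, and the rest is evaluated on the frame.
\<close>

lemma sigma_form_shell_density:
  fixes x :: "complex^'m"
  assumes x: "x \<noteq> 0" and r: "r > 0"
  shows "wedge 1 (2 * CARD('m) - 1) (\<lambda>v. of_real (frechet_derivative norm (at x) (v 0)))
      (\<lambda>v. sigma_form (radial_proj r x) (\<lambda>i. frechet_derivative (radial_proj r) (at x) (v i)))
      std_frame = of_real (shell_density x)"
proof -
  obtain k where k: "CARD('m) = Suc k" by (cases "CARD('m)") auto
  define N where "N = x \<bullet> x"
  have N: "N > 0" using x by (simp add: N_def)
  have nN: "norm x * norm x = N" by (simp add: N_def dot_square_norm power2_eq_square)
  have n: "norm x > 0" using x by simp
  define DP where "DP h = (r / norm x) *\<^sub>R (h - ((x \<bullet> h) / N) *\<^sub>R x)" for h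
  have fP: "frechet_derivative (radial_proj r) (at x) = DP"
    using frechet_derivative_at[OF has_derivative_radial_proj[OF x, of r]] by (simp add: DP_def[abs_def] N_def)
  have fn: "frechet_derivative norm (at x) h = (x \<bullet> h) / norm x" for h
    using frechet_derivative_at[OF has_derivative_norm[OF x]]
    by (metis divide_inverse inner_commute inner_scaleR_left mult.commute sgn_div_norm)
  define y where "y = radial_proj r x"
  have y: "y = (r / norm x) *\<^sub>R x" by (simp add: y_def radial_proj_def)
  have y0: "y \<noteq> 0" using x r by (simp add: y)
  have yy: "y \<bullet> y = r * r" using n by (simp add: y dot_square_norm power2_eq_square)
  have yD: "y \<bullet> DP h = 0" for h
    using N by (simp add: y DP_def inner_diff_right N_def[symmetric])
  have yJ: "y \<bullet> J (DP h) = r\<^sup>2 / N * (x \<bullet> J h)" for h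
    using n by (simp add: y DP_def J_scale J_diff inner_diff_right J_inner_self nN[symmetric] power2_eq_square)
  define a where "a h = complex_of_real ((x \<bullet> h) / norm x)" for h :: "complex^'m"
  define b where "b h = complex_of_real (- (x \<bullet> J h) / (2 * pi * N))" for h :: "complex^'m"
  define w where "w g h = omega_form y (\<lambda>i. if i = 0 then DP g else DP h)" for g h
  define \<kappa> where "\<kappa> = complex_of_real (1 / (pi * N))"
  have dc: "dc_form (\<lambda>z. ln (tau z)) y (\<lambda>i. DP (v i)) = b (v 0)" for v
    unfolding dc_ln_tau[OF y0] yJ yy b_def using r by (simp add: power2_eq_square field_simps)
  have om: "omega_form y (\<lambda>i. DP (v i)) = w (v 0) (v 1)" for v
    unfolding w_def by (simp add: omega_form_eq[OF y0])
  \<comment> \<open>The part of \<open>\<omega>\<close> on the complex line through \<open>x\<close> is a multiple of \<open>a \<and> b\<close>.\<close>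
  have weq: "w g h = \<kappa> * of_real (J g \<bullet> h) + of_real (- 2 / norm x) * (a g * b h - a h * b g)" for g h
  proof -
    have "w g h = of_real ((J (DP g) \<bullet> DP h) / (pi * (r * r)))"
      unfolding w_def by (simp add: omega_form_eq[OF y0] yD yy)
    also have "J (DP g) \<bullet> DP h = r\<^sup>2 / N * (J g \<bullet> h + ((x \<bullet> g) * (x \<bullet> J h) - (x \<bullet> h) * (x \<bullet> J g)) / N)"
    proof -
      have "J (DP g) \<bullet> DP h = (r / norm x) * (r / norm x) * 
          ((J g - ((x \<bullet> g) / N) *\<^sub>R J x) \<bullet> (h - ((x \<bullet> h) / N) *\<^sub>R x))"
        by (simp add: DP_def J_scale J_diff)
      also have "(r / norm x) * (r / norm x) = r\<^sup>2 / N" by (simp add: nN power2_eq_square)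
      also have "(J g - ((x \<bullet> g) / N) *\<^sub>R J x) \<bullet> (h - ((x \<bullet> h) / N) *\<^sub>R x)
          = J g \<bullet> h + ((x \<bullet> g) * (x \<bullet> J h) - (x \<bullet> h) * (x \<bullet> J g)) / N"
        using N by (simp add: inner_diff_left inner_diff_right J_inner_self J_inner_swap[of x h]
          inner_commute[of "J g" x] field_simps)
      finally show ?thesis .
    qed
    also have "of_real (r\<^sup>2 / N * (J g \<bullet> h + ((x \<bullet> g) * (x \<bullet> J h) - (x \<bullet> h) * (x \<bullet> J g)) / N) / (pi * (r * r)))
        = of_real ((J g \<bullet> h) / (pi * N) + - 2 / norm x * ((x \<bullet> g) / norm x * (- (x \<bullet> J h) / (2 * pi * N))
            - (x \<bullet> h) / norm x * (- (x \<bullet> J g) / (2 * pi * N))))"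
    proof -
      have 1: "r\<^sup>2 / N * A / (pi * (r * r)) = A / (pi * N)" for A
        using r by (simp add: power2_eq_square)
      have 2: "- 2 / norm x * (p / norm x * (- q / (2 * pi * N)) - s / norm x * (- t / (2 * pi * N)))
          = (p * q - s * t) / (pi * N * (norm x * norm x))" for p q s t
        using n N by (simp add: field_simps)
      show ?thesis unfolding 1 2 nN using N by (simp add: field_simps)
    qed
    finally show ?thesis by (simp add: \<kappa>_def a_def b_def)
  qed
  let ?e = "std_frame :: nat \<Rightarrow> complex^'m"
  have "wedge 1 (2 * CARD('m) - 1) (\<lambda>v. of_real (frechet_derivative norm (at x) (v 0)))
      (\<lambda>v. sigma_form (radial_proj r x) (\<lambda>i. frechet_derivative (radial_proj r) (at x) (v i))) ?e
    = wedge 1 (2 * k + 1) (\<lambda>v. a (v 0)) (wedge 1 (2 * k) (\<lambda>v. b (v 0)) (wedge_power2 k (\<lambda>v. w (v 0) (v 1)))) ?e"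
    unfolding sigma_form_def fP y_def[symmetric] k fn a_def[symmetric]
    by (simp add: wedge_pullback[abs_def] wedge_power2_pullback dc om)
  also have "\<dots> = 1 / 2 ^ k * alternation (2 * Suc k)
        (\<lambda>v. a (v 0) * (b (v 1) * (\<Prod>j<k. w (v (2 * Suc j)) (v (2 * Suc j + 1))))) ?e"
    by (rule nested_wedge_alternation)
  also have "\<dots> = 1 / 2 ^ k * alternation (2 * Suc k)
        (\<lambda>v. a (v 0) * (b (v 1) * (\<Prod>j<k. \<kappa> * of_real (J (v (2 * Suc j)) \<bullet> v (2 * Suc j + 1))))) ?e"
    by (subst alternation_modify_factor[of w "\<lambda>g h. \<kappa> * of_real (J g \<bullet> h)", OF weq]) (rule refl)
  also have "\<dots> = 1 / 2 ^ Suc k * (2 * (\<Sum>\<pi> | \<pi> permutes {..<2 * Suc k}. of_int (sign \<pi>) *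
      (a (?e (\<pi> 0)) * (b (?e (\<pi> 1)) * (\<Prod>j<k. \<kappa> * of_int (pairing (\<pi> (2 * Suc j)) (\<pi> (2 * Suc j + 1))))))))"
  proof -
    have "alternation (2 * Suc k)
        (\<lambda>v. a (v 0) * (b (v 1) * (\<Prod>j<k. \<kappa> * of_real (J (v (2 * Suc j)) \<bullet> v (2 * Suc j + 1))))) ?e
      = (\<Sum>\<pi> | \<pi> permutes {..<2 * Suc k}. of_int (sign \<pi>) *
      (a (?e (\<pi> 0)) * (b (?e (\<pi> 1)) * (\<Prod>j<k. \<kappa> * of_int (pairing (\<pi> (2 * Suc j)) (\<pi> (2 * Suc j + 1)))))))"
      unfolding alternation_def
    proof (intro sum.cong refl arg_cong2[of _ _ _ _ "(*)"] prod.cong)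
      fix \<pi> j assume "\<pi> \<in> {\<pi>. \<pi> permutes {..<2 * Suc k}}" and j: "j \<in> {..<k}"
      then have "\<pi> i < 2 * CARD('m)" if "i < 2 * Suc k" for i
        using permutes_in_image[of \<pi> "{..<2 * Suc k}" i] that k by simp
      then have "J (?e (\<pi> (2 * Suc j))) \<bullet> ?e (\<pi> (2 * Suc j + 1)) = of_int (pairing (\<pi> (2 * Suc j)) (\<pi> (2 * Suc j + 1)))"
        using j by (intro std_frame_pairing) auto
      then show "complex_of_real (J (?e (\<pi> (2 * Suc j))) \<bullet> ?e (\<pi> (2 * Suc j + 1)))
          = of_int (pairing (\<pi> (2 * Suc j)) (\<pi> (2 * Suc j + 1)))"
        by simp
    qed
    then show ?thesis by simp
  qed
  also have "\<dots> = 1 / 2 ^ Suc k * (\<kappa> ^ k * (\<Sum>\<pi> | \<pi> permutes {..<2 * Suc k}. of_int (block_coeff (Suc k) \<pi>) *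
      of_real ((cmod (x $ from_nat_into UNIV (\<pi> 0 div 2)))\<^sup>2 / (2 * pi * N * norm x))))"
  proof (subst alternation_block[where a = "\<lambda>i. a (?e i)" and b = "\<lambda>i. b (?e i)" and q = "\<lambda>l. of_real ((cmod (x $ from_nat_into UNIV l))\<^sup>2 / (2 * pi * N * norm x))"])
    fix i j :: nat assume "i div 2 = j div 2"
    from std_frame_minor[OF this, of x]
    have "((x \<bullet> ?e i) * - (x \<bullet> J (?e j)) - (x \<bullet> ?e j) * - (x \<bullet> J (?e i))) / (2 * pi * N * norm x)
      = of_int (pairing i j) * ((cmod (x $ from_nat_into UNIV (i div 2)))\<^sup>2 / (2 * pi * N * norm x))"
      by simp
    then have "(x \<bullet> ?e i) / norm x * (- (x \<bullet> J (?e j)) / (2 * pi * N)) - (x \<bullet> ?e j) / norm x * (- (x \<bullet> J (?e i)) / (2 * pi * N))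
      = of_int (pairing i j) * ((cmod (x $ from_nat_into UNIV (i div 2)))\<^sup>2 / (2 * pi * N * norm x))"
      by (simp add: diff_divide_distrib mult_ac)
    from arg_cong[OF this, of complex_of_real]
    show "a (?e i) * b (?e j) - a (?e j) * b (?e i) = of_int (pairing i j) *
        of_real ((cmod (x $ from_nat_into UNIV (i div 2)))\<^sup>2 / (2 * pi * N * norm x))"
      by (simp only: a_def b_def of_real_mult of_real_diff of_real_of_int_eq)
  qed simp
  also have "\<dots> = of_real (shell_density x)"
    unfolding shell_density_def k N_def[symmetric] \<kappa>_def by simp
  finally show ?thesis .
qed

lemma sphere_integral_eq:
  fixes u :: "complex^'m \<Rightarrow> real"
  assumes "r > 0"
  shows "sphere_integral r (\<lambda>z v. of_real (u z) * sigma_form z v)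
    = of_real (LINT x : {x. 1 < norm x \<and> norm x < 2} | lborel. u (radial_proj r x) * shell_density x)"
proof -
  let ?S = "{x::complex^'m. 1 < norm x \<and> norm x < 2}"
  have scale: "wedge p q \<alpha> (\<lambda>v. c * \<beta> v) v = c * wedge p q \<alpha> \<beta> v" for p q and \<alpha> \<beta> :: "(complex^'m) form" and c v
    by (simp add: wedge_def sum_distrib_left mult_ac)
  have "sphere_integral r (\<lambda>z v. of_real (u z) * sigma_form z v)
    = (LINT x : ?S | lborel. complex_of_real (u (radial_proj r x) * shell_density x))"
    unfolding sphere_integral_def set_lebesgue_integral_def
  proof (intro Bochner_Integration.integral_cong refl)
    fix x :: "complex^'m"
    show "indicat_real ?S x *\<^sub>R wedge 1 (2 * CARD('m) - 1)
        (\<lambda>v. of_real (frechet_derivative norm (at x) (v 0)))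
        (\<lambda>v. of_real (u (radial_proj r x)) *
           sigma_form (radial_proj r x) (\<lambda>i. frechet_derivative (radial_proj r) (at x) (v i))) std_frame
      = indicat_real ?S x *\<^sub>R complex_of_real (u (radial_proj r x) * shell_density x)"
    proof (cases "x \<in> ?S")
      case True
      then have "x \<noteq> 0" by auto
      from sigma_form_shell_density[OF this assms] show ?thesis by (simp only: scale of_real_mult)
    qed simp
  qed
  also have "\<dots> = of_real (LINT x : ?S | lborel. u (radial_proj r x) * shell_density x)"
    unfolding set_lebesgue_integral_def by (simp add: scaleR_conv_of_real of_real_mult[symmetric] del: of_real_mult)
  finally show ?thesis .
qed

lemma shell_density_lower:
  fixes x :: "complex^'m"
  assumes "1 < norm x" "norm x < 2"
  shows "shell_density x \<ge> (1 / (pi * 4)) ^ (CARD('m) - 1) / 2 ^ CARD('m) / (4 * pi)"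
proof -
  define g where "g = from_nat_into (UNIV :: 'm set)"
  define c where "c = 2 * pi * (x \<bullet> x) * norm x"
  have nx: "x \<bullet> x = norm x ^ 2" by (simp add: power2_norm_eq_inner)
  have pos: "x \<bullet> x > 0" using assms by (auto simp: nx)
  have cpos: "c > 0" unfolding c_def using pos assms by (intro mult_pos_pos) auto
  have bij: "bij_betw g {..<CARD('m)} UNIV" unfolding g_def by (rule bij_betw_from_nat_into_finite) simp
  have "1 / (4 * pi) \<le> 1 / (2 * pi * norm x)" using assms by (intro divide_left_mono mult_pos_pos) auto
  also have "\<dots> = (x \<bullet> x) / c" using pos by (simp add: c_def)
  also have "x \<bullet> x = (\<Sum>p\<in>UNIV. (cmod (x $ p))\<^sup>2)"
    by (simp add: inner_vec_def dot_square_norm)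
  also have "\<dots> = (\<Sum>l<CARD('m). (cmod (x $ g l))\<^sup>2)" by (rule sum.reindex_bij_betw[OF bij, symmetric])
  also have "\<dots> / c = (\<Sum>l<CARD('m). (cmod (x $ g l))\<^sup>2 / c)" by (rule sum_divide_distrib)
  also have "\<dots> \<le> (\<Sum>\<pi> | \<pi> permutes {..<2 * CARD('m)}. of_int (block_coeff (CARD('m)) \<pi>) *
        ((cmod (x $ g (\<pi> 0 div 2)))\<^sup>2 / c))"
    using cpos by (intro block_coeff_sum_ge) auto
  finally have 1: "1 / (4 * pi) \<le> (\<Sum>\<pi> | \<pi> permutes {..<2 * CARD('m)}. of_int (block_coeff (CARD('m)) \<pi>) *
        ((cmod (x $ g (\<pi> 0 div 2)))\<^sup>2 / c))" (is "_ \<le> ?S") .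
  have "x \<bullet> x \<le> 4" unfolding nx using power_mono[of "norm x" 2 2] assms by simp
  then have "1 / (pi * 4) \<le> 1 / (pi * (x \<bullet> x))" using pos by (intro divide_left_mono mult_pos_pos mult_left_mono) auto
  then have "(1 / (pi * 4)) ^ (CARD('m) - 1) \<le> (1 / (pi * (x \<bullet> x))) ^ (CARD('m) - 1)"
    by (intro power_mono) auto
  then have "(1 / (pi * 4)) ^ (CARD('m) - 1) / 2 ^ CARD('m) * (1 / (4 * pi))
      \<le> (1 / (pi * (x \<bullet> x))) ^ (CARD('m) - 1) / 2 ^ CARD('m) * ?S"
    using 1 by (intro mult_mono divide_right_mono) auto
  then show ?thesis by (simp add: shell_density_def g_def c_def)
qed

lemma continuous_on_shell_density: "continuous_on {x :: complex^'m. x \<noteq> 0} shell_density"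
  unfolding shell_density_def[abs_def] by (auto intro!: continuous_intros)

section \<open>Sub-mean value property\<close>

lemma nn_integral_lborel_translate:
  fixes g :: "'a::euclidean_space \<Rightarrow> ennreal"
  assumes [measurable]: "g \<in> borel_measurable borel"
  shows "(\<integral>\<^sup>+x. g (c + x) \<partial>lborel) = (\<integral>\<^sup>+x. g x \<partial>lborel)"
  by (subst (2) lborel_distr_plus[of c, symmetric], subst nn_integral_distr) auto

text \<open>
  Rotation invariance of Lebesgue measure, by the uniqueness argument for translation invariant
  measures: with \<open>B\<close> the unit ball, the double integral of \<open>1\<^sub>B(x) g(x + T y)\<close> is computed in both orders.
  One order gives \<open>\<bar>B\<bar>\<close> times the integral of \<open>g \<circ> T\<close>, the other one, as \<open>T\<close> preserves balls, \<open>\<bar>B\<bar>\<close>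
  times the integral of \<open>g\<close>.
\<close>

lemma nn_integral_lborel_isometry:
  fixes g :: "'a::euclidean_space \<Rightarrow> ennreal" and T :: "'a \<Rightarrow> 'a"
  assumes T: "linear T" "\<And>x. norm (T x) = norm x" and g[measurable]: "g \<in> borel_measurable borel"
  shows "(\<integral>\<^sup>+x. g (T x) \<partial>lborel) = (\<integral>\<^sup>+x. g x \<partial>lborel)"
proof -
  have inj: "inj T"
    unfolding linear_injective_0[OF T(1)] using T(2) by (metis norm_eq_zero)
  then have surj: "surj T" by (rule linear_inj_imp_surj[OF T(1)])
  have [measurable]: "T \<in> borel_measurable borel"
    by (intro borel_measurable_continuous_onI linear_continuous_on linear_conv_bounded_linear[THEN iffD1] T)
  define B where "B = ball (0::'a) 1"
  have [measurable]: "B \<in> sets borel" by (simp add: B_def)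
  let ?K = "\<integral>\<^sup>+x. \<integral>\<^sup>+y. indicator B x * g (x + T y) \<partial>lborel \<partial>lborel"
  have "?K = (\<integral>\<^sup>+x. indicator B x * (\<integral>\<^sup>+y. g (T y) \<partial>lborel) \<partial>lborel)"
  proof (rule nn_integral_cong)
    fix x
    obtain a where a: "x = T a" using surj by (metis surjD)
    have "(\<integral>\<^sup>+y. indicator B x * g (x + T y) \<partial>lborel) = indicator B x * (\<integral>\<^sup>+y. g (T (a + y)) \<partial>lborel)"
      by (simp add: nn_integral_cmult a linear_add[OF T(1)])
    also have "(\<integral>\<^sup>+y. g (T (a + y)) \<partial>lborel) = (\<integral>\<^sup>+y. g (T y) \<partial>lborel)"
      by (rule nn_integral_lborel_translate) measurable
    finally show "(\<integral>\<^sup>+y. indicator B x * g (x + T y) \<partial>lborel) = indicator B x * (\<integral>\<^sup>+y. g (T y) \<partial>lborel)" .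
  qed
  also have "\<dots> = emeasure lborel B * (\<integral>\<^sup>+y. g (T y) \<partial>lborel)"
    by (simp add: nn_integral_multc)
  finally have 1: "?K = emeasure lborel B * (\<integral>\<^sup>+y. g (T y) \<partial>lborel)" .
  have "?K = (\<integral>\<^sup>+y. \<integral>\<^sup>+x. indicator B x * g (x + T y) \<partial>lborel \<partial>lborel)"
    by (rule lborel_pair.Fubini'[symmetric]) measurable
  also have "\<dots> = (\<integral>\<^sup>+y. \<integral>\<^sup>+x. indicator B (x - T y) * g x \<partial>lborel \<partial>lborel)"
  proof (rule nn_integral_cong)
    fix y
    have "(\<integral>\<^sup>+x. indicator B (x - T y) * g x \<partial>lborel) = (\<integral>\<^sup>+x. indicator B ((T y + x) - T y) * g (T y + x) \<partial>lborel)"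
      by (rule nn_integral_lborel_translate[symmetric]) measurable
    then show "(\<integral>\<^sup>+x. indicator B x * g (x + T y) \<partial>lborel)
        = (\<integral>\<^sup>+x. indicator B (x - T y) * g x \<partial>(lborel :: 'a measure))"
      by (simp add: add.commute)
  qed
  also have "\<dots> = (\<integral>\<^sup>+x. \<integral>\<^sup>+y. indicator B (x - T y) * g x \<partial>lborel \<partial>lborel)"
    by (rule lborel_pair.Fubini') measurable
  also have "\<dots> = (\<integral>\<^sup>+x. emeasure lborel B * g x \<partial>lborel)"
  proof (rule nn_integral_cong)
    fix x
    obtain a where a: "x = T a" using surj by (metis surjD)
    have "norm (x - T y) = norm (- a + y)" for y
      by (metis T a linear_diff norm_minus_commute uminus_add_conv_diff)
    then have "indicator B (x - T y) = (indicator B (- a + y) :: ennreal)" for y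
      by (simp add: indicator_def B_def)
    then have "(\<integral>\<^sup>+y. indicator B (x - T y) * g x \<partial>lborel) = (\<integral>\<^sup>+y. indicator B (- a + y) \<partial>lborel) * g x"
      by (simp add: nn_integral_multc)
    also have "(\<integral>\<^sup>+y. indicator B (- a + y) \<partial>lborel) = (\<integral>\<^sup>+y. indicator B y \<partial>lborel)"
      by (rule nn_integral_lborel_translate) measurable
    finally show "(\<integral>\<^sup>+y. indicator B (x - T y) * g x \<partial>lborel) = emeasure lborel B * g x" by simp
  qed
  also have "\<dots> = emeasure lborel B * (\<integral>\<^sup>+x. g x \<partial>lborel)" by (simp add: nn_integral_cmult)
  finally have "emeasure lborel B * (\<integral>\<^sup>+y. g (T y) \<partial>lborel) = emeasure lborel B * (\<integral>\<^sup>+x. g x \<partial>lborel)"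
    using 1 by simp
  moreover have "emeasure lborel B \<noteq> top"
    using emeasure_lborel_ball_finite[of "0::'a" 1] by (simp add: B_def)
  moreover have "emeasure lborel B \<noteq> 0"
  proof -
    have "unit_ball_vol (real DIM('a)) \<noteq> 0"
      by (rule less_imp_neq[THEN not_sym], rule unit_ball_vol_pos) simp
    then show ?thesis by (simp add: B_def emeasure_ball)
  qed
  ultimately show ?thesis by (simp add: ennreal_mult_cancel_left)
qed

lemma log_plus_nonneg: "log_plus x \<ge> 0" by (simp add: log_plus_def)

text \<open>
  A discrete sub-mean value property that avoids Jensen's formula: the product
  \<open>G(t) = \<Prod>\<^sub>k F(w\<^sup>k t)\<close> is holomorphic, so \<open>\<bar>F(0)\<bar>\<^sup>N = \<bar>G(0)\<bar>\<close> is at most the maximum of \<open>\<bar>G\<bar>\<close> on the unit circle.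
\<close>

lemma log_plus_mean_le_circle_bound:
  assumes hol: "F holomorphic_on UNIV" and N: "N > 0" and w: "cmod w = 1"
    and S: "\<And>t. cmod t = 1 \<Longrightarrow> (\<Sum>k<N. log_plus (cmod (F (w ^ k * t)))) \<le> S"
  shows "real N * log_plus (cmod (F 0)) \<le> S"
proof -
  define G where "G t = (\<Prod>k<N. F (w ^ k * t))" for t
  have "(F \<circ> (\<lambda>t. w ^ k * t)) holomorphic_on UNIV" for k
    by (intro holomorphic_on_compose_gen[of _ _ F UNIV] hol holomorphic_intros) auto
  then have "(\<lambda>t. F (w ^ k * t)) holomorphic_on UNIV" for k by (simp add: o_def)
  then have G: "G holomorphic_on UNIV" unfolding G_def by (intro holomorphic_intros)
  have bd: "cmod (G t) \<le> exp S" if "cmod t = 1" for t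
  proof -
    have "cmod (G t) = (\<Prod>k<N. cmod (F (w ^ k * t)))" by (simp add: G_def prod_norm)
    also have "\<dots> \<le> (\<Prod>k<N. exp (log_plus (cmod (F (w ^ k * t)))))"
      by (intro prod_mono) (auto simp: log_plus_def)
    also have "\<dots> = exp (\<Sum>k<N. log_plus (cmod (F (w ^ k * t))))" by (simp add: exp_sum)
    also have "\<dots> \<le> exp S" using S[OF that] by simp
    finally show ?thesis .
  qed
  have "cmod ((deriv ^^ 0) G 0) \<le> fact 0 * exp S / 1 ^ 0"
  proof (rule Cauchy_inequality)
    show "G holomorphic_on ball 0 1" using G holomorphic_on_subset by blast
    show "continuous_on (cball 0 1) G" 
      using G holomorphic_on_imp_continuous_on holomorphic_on_subset by blast
  qed (use bd in auto)
  then have le: "cmod (F 0) ^ N \<le> exp S" by (simp add: G_def norm_power)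
  have "0 \<le> (\<Sum>k<N. log_plus (cmod (F (w ^ k * 1))))" by (intro sum_nonneg log_plus_nonneg)
  then have S0: "0 \<le> S" using S[of 1] by simp
  show ?thesis
  proof (cases "cmod (F 0) \<le> 1")
    case False
    then have "real N * ln (cmod (F 0)) = ln (cmod (F 0) ^ N)" by (simp add: ln_realpow)
    also have "\<dots> \<le> S" using le False by (metis exp_gt_zero ln_exp ln_le_cancel_iff zero_less_power linorder_not_le less_trans zero_less_one)
    finally show ?thesis using False by (simp add: log_plus_def)
  qed (use S0 in \<open>simp add: log_plus_def\<close>)
qed

lemma sum_cyclic_shift:
  fixes h :: "'a::monoid_mult \<Rightarrow> real"
  assumes "w ^ N = 1"
  shows "(\<Sum>k<N. h (w ^ (k + j))) = (\<Sum>k<N. h (w ^ k))"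
proof (induction j)
  case (Suc j)
  have "(\<Sum>k<N. h (w ^ (k + Suc j))) + h (w ^ j) = (\<Sum>k<Suc N. h (w ^ (k + j)))"
    by (simp add: sum.lessThan_Suc_shift del: sum.lessThan_Suc)
  also have "\<dots> = (\<Sum>k<N. h (w ^ (k + j))) + h (w ^ j)"
    using assms by (simp add: power_add)
  finally show ?case using Suc by simp
qed simp

lemma unit_circle_near_root_of_unity:
  assumes "cmod t = 1" and N: "N > 0"
  obtains j s where "t = cis (2 * pi / real N) ^ j * s" "cmod s = 1" "cmod (s - 1) \<le> 2 * pi / real N"
proof -
  define \<theta> where "\<theta> = Arg2pi t"
  have t: "t = cis \<theta>" and \<theta>: "0 \<le> \<theta>"
    using assms Arg2pi_eq[of t] Arg2pi_ge_0[of t] by (simp_all add: \<theta>_def cis_conv_exp)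
  define d where "d = 2 * pi / real N"
  have d: "d > 0" using N by (simp add: d_def)
  define j where "j = nat \<lfloor>\<theta> / d\<rfloor>"
  have j: "real j \<le> \<theta> / d" "\<theta> / d < real j + 1"
    using \<theta> d by (simp_all add: j_def)
  define e where "e = \<theta> - real j * d"
  have e: "0 \<le> e" "e \<le> d" using j d by (simp_all add: e_def field_simps)
  show thesis
  proof (rule that[of j "cis e"])
    show "t = cis (2 * pi / real N) ^ j * cis e"
      by (simp add: d_def[symmetric] t e_def Complex.DeMoivre cis_mult)
    have "cmod (cis e - 1) = 2 * \<bar>sin (e / 2)\<bar>" by (simp add: cis_conv_exp dist_exp_i_1)
    also have "\<dots> \<le> e" using sin_x_le_x[of "e / 2"] sin_x_ge_neg_x[of "e / 2"] e(1) by simp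
    finally show "cmod (cis e - 1) \<le> 2 * pi / real N" using e by (simp add: d_def)
  qed simp
qed

lemma entire_Cm_continuous: "entire_Cm f \<Longrightarrow> continuous_on UNIV f"
  unfolding entire_Cm_def by (metis has_derivative_continuous continuous_at_imp_continuous_on)

lemma norm_vector_smult: "norm (c *s (v :: complex^'m)) = cmod c * norm v"
  by (simp add: norm_vec_def L2_set_def norm_mult power_mult_distrib sum_distrib_left[symmetric] real_sqrt_mult)

lemma log_plus_entire_continuous:
  assumes "entire_Cm f"
  shows "continuous_on S (\<lambda>z. log_plus (cmod (f z)))"
  using continuous_on_subset[OF entire_Cm_continuous[OF assms], of S]
  unfolding log_plus_def by (auto intro!: continuous_intros)

text \<open>
  When \<open>w\<close> is a primitive \<open>N\<close>-th root of unity, the sum over the points \<open>w\<^sup>k t\<close> does not change if \<open>t\<close> is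
  multiplied by a power of \<open>w\<close>. So \<open>t\<close> may be taken close to \<open>1\<close>, and by uniform continuity it may be replaced
  by \<open>1\<close> at the cost of \<open>e\<close>, with \<open>N\<close> independent of the direction \<open>v\<close>.
\<close>

lemma log_plus_mean_le_roots:
  fixes f :: "complex^'m \<Rightarrow> complex"
  assumes f: "entire_Cm f" and e: "e > 0" and s: "s \<ge> 0"
  obtains N where "N > 0" "\<And>v. norm v \<le> s \<Longrightarrow>
    real N * log_plus (cmod (f z)) \<le> (\<Sum>k<N. log_plus (cmod (f (z + cis (2 * pi / real N) ^ k *s v)))) + real N * e"
proof -
  define u where "u z = log_plus (cmod (f z))" for z
  have "uniformly_continuous_on (cball z s) u"
    unfolding u_def by (intro compact_uniformly_continuous log_plus_entire_continuous f) auto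
  then obtain d where d: "d > 0" "\<And>x y. x \<in> cball z s \<Longrightarrow> y \<in> cball z s \<Longrightarrow> dist y x < d \<Longrightarrow> dist (u y) (u x) < e"
    unfolding uniformly_continuous_on_def using e by metis
  obtain N where N: "2 * pi * (s + 1) / d < real N" using reals_Archimedean2 by blast
  have "0 < 2 * pi * (s + 1) / d" using d s by simp
  then have N0: "N > 0" using N by (cases N) auto
  have Nd: "2 * pi / real N * s < d"
  proof -
    have "2 * pi * (s + 1) < real N * d" using N d by (simp add: field_simps)
    moreover have "2 * pi * s < 2 * pi * (s + 1)" by simp
    ultimately have "2 * pi * s < real N * d" by linarith
    then show ?thesis using N0 by (simp add: field_simps)
  qed
  define w where "w = cis (2 * pi / real N)"
  have w1: "cmod w = 1" by (simp add: w_def)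
  have wN: "w ^ N = 1" using N0 by (simp add: w_def Complex.DeMoivre)
  have "real N * u z \<le> (\<Sum>k<N. u (z + w ^ k *s v)) + real N * e" if v: "norm v \<le> s" for v
  proof -
    define F where "F t = f (z + t *s v)" for t
    have hol: "F holomorphic_on UNIV"
      unfolding F_def by (rule entire_Cm_line_holomorphic[OF f])
    have "real N * log_plus (cmod (F 0)) \<le> (\<Sum>k<N. u (z + w ^ k *s v)) + real N * e"
    proof (rule log_plus_mean_le_circle_bound[OF hol N0 w1])
      fix t assume t: "cmod t = 1"
      obtain j \<sigma> where j: "t = w ^ j * \<sigma>" "cmod \<sigma> = 1" "cmod (\<sigma> - 1) \<le> 2 * pi / real N"
        using unit_circle_near_root_of_unity[OF t N0] unfolding w_def by metis
      have close: "u (z + (q * \<sigma>) *s v) \<le> u (z + q *s v) + e" if q: "cmod q = 1" for q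
      proof -
        have "dist (z + (q * \<sigma>) *s v) (z + q *s v) = norm ((q * (\<sigma> - 1)) *s v)"
          by (simp add: dist_norm vec_eq_iff algebra_simps vector_sub_rdistrib)
        also have "\<dots> = cmod (\<sigma> - 1) * norm v" using q by (simp add: norm_vector_smult norm_mult)
        also have "\<dots> \<le> 2 * pi / real N * s" using j v by (intro mult_mono) auto
        also have "\<dots> < d" by (rule Nd)
        finally have "dist (u (z + (q * \<sigma>) *s v)) (u (z + q *s v)) < e"
          using v q j by (intro d) (auto simp: dist_norm norm_vector_smult norm_mult)
        then show ?thesis by (simp add: dist_norm)
      qed
      have "(\<Sum>k<N. log_plus (cmod (F (w ^ k * t)))) = (\<Sum>k<N. u (z + (w ^ (k + j) * \<sigma>) *s v))"
        by (simp add: F_def u_def j power_add mult.assoc)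
      also have "\<dots> \<le> (\<Sum>k<N. u (z + w ^ (k + j) *s v) + e)"
        by (intro sum_mono close) (simp add: norm_power w1)
      also have "\<dots> = (\<Sum>k<N. u (z + w ^ k *s v)) + real N * e"
        using sum_cyclic_shift[OF wN, of "\<lambda>q. u (z + q *s v)" j] by (simp add: sum.distrib)
      finally show "(\<Sum>k<N. log_plus (cmod (F (w ^ k * t)))) \<le> \<dots>" .
    qed
    then show ?thesis by (simp add: F_def u_def)
  qed
  then show thesis using that[OF N0] by (simp add: u_def w_def)
qed

text \<open>
  The discrete mean value inequality is integrated over all \<open>v\<close> in a ball. Each of its \<open>N\<close> terms
  has the same integral, because multiplication by \<open>w\<^sup>k\<close> is an isometry.
\<close>

lemma log_plus_sub_mean_value:
  fixes f :: "complex^'m \<Rightarrow> complex"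
  assumes f: "entire_Cm f" and s: "s > 0" and r: "r > 0"
  shows "ennreal (log_plus (cmod (f z))) * emeasure lborel (cball (0 :: complex^'m) s)
    \<le> (\<integral>\<^sup>+v. indicator (cball 0 s) v * ennreal (log_plus (cmod (f (z + r *\<^sub>R v)))) \<partial>lborel)"
proof (rule ennreal_le_epsilon)
  fix e :: real assume e: "e > 0"
  define u where "u z = log_plus (cmod (f z))" for z
  have u0: "u z \<ge> 0" for z by (simp add: u_def log_plus_nonneg)
  have "continuous_on UNIV u" unfolding u_def by (rule log_plus_entire_continuous[OF f])
  then have [measurable]: "u \<in> borel_measurable borel" by (rule borel_measurable_continuous_onI)
  let ?B = "cball (0 :: complex^'m) s"
  have [measurable]: "?B \<in> sets borel" by simp
  have lin: "linear (\<lambda>v :: complex^'m. c *s v)" for c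
    by (rule linearI) (simp_all add: vec_eq_iff distrib_left)
  then have [measurable]: "(\<lambda>v :: complex^'m. c *s v) \<in> borel_measurable borel" for c
    by (intro borel_measurable_continuous_onI linear_continuous_on) (simp add: linear_conv_bounded_linear)
  define b where "b = measure lborel ?B"
  have b: "b > 0" unfolding b_def using content_cball_pos[OF s, of "0 :: complex^'m"] by simp
  have eb: "emeasure lborel ?B = ennreal b"
    unfolding b_def using emeasure_lborel_cball_finite[of "0 :: complex^'m" s]
    by (subst emeasure_eq_ennreal_measure) auto
  obtain N where N: "N > 0" "\<And>v. norm v \<le> r * s \<Longrightarrow>
      real N * u z \<le> (\<Sum>k<N. u (z + cis (2 * pi / real N) ^ k *s v)) + real N * (e / b)"
    using log_plus_mean_le_roots[OF f, of "e / b" "r * s" z] e b r s unfolding u_def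
    by (metis divide_pos_pos less_imp_le mult_pos_pos)
  define w where "w = cis (2 * pi / real N)"
  have w1: "cmod w = 1" by (simp add: w_def)
  define I where "I = (\<integral>\<^sup>+v. indicator ?B v * ennreal (u (z + r *\<^sub>R v)) \<partial>lborel)"
  have rot: "(\<integral>\<^sup>+v. indicator ?B v * ennreal (u (z + r *\<^sub>R (w ^ k *s v))) \<partial>lborel) = I" for k
  proof -
    have nk: "norm (w ^ k *s v) = norm v" for v :: "complex^'m"
      by (simp add: norm_vector_smult norm_power w1)
    have "(\<integral>\<^sup>+v. (\<lambda>v. indicator ?B v * ennreal (u (z + r *\<^sub>R v))) (w ^ k *s v) \<partial>lborel) = I"
      unfolding I_def by (rule nn_integral_lborel_isometry[OF lin nk]) measurable
    then show ?thesis by (simp add: indicator_def nk)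
  qed
  have "ennreal (real N) * (ennreal (u z) * ennreal b) = (\<integral>\<^sup>+v. indicator ?B v * ennreal (real N * u z) \<partial>lborel)"
    by (subst nn_integral_multc) (simp_all add: eb ennreal_mult u0 mult_ac)
  also have "\<dots> \<le> (\<integral>\<^sup>+v. (\<Sum>k<N. indicator ?B v * ennreal (u (z + r *\<^sub>R (w ^ k *s v))))
      + indicator ?B v * ennreal (real N * (e / b)) \<partial>lborel)"
  proof (rule nn_integral_mono)
    fix v :: "complex^'m"
    show "indicator ?B v * ennreal (real N * u z) \<le> (\<Sum>k<N. indicator ?B v * ennreal (u (z + r *\<^sub>R (w ^ k *s v))))
      + indicator ?B v * ennreal (real N * (e / b))"
    proof (cases "v \<in> ?B")
      case True
      have "c *s (r *\<^sub>R v) = r *\<^sub>R (c *s v)" for c by (simp add: vec_eq_iff)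
      then have "real N * u z \<le> (\<Sum>k<N. u (z + r *\<^sub>R (w ^ k *s v))) + real N * (e / b)"
        using N(2)[of "r *\<^sub>R v"] True r by (simp add: w_def)
      then have "ennreal (real N * u z) \<le> ennreal ((\<Sum>k<N. u (z + r *\<^sub>R (w ^ k *s v))) + real N * (e / b))"
        by (rule ennreal_leI)
      then show ?thesis using True e b by (simp add: ennreal_plus sum_nonneg u0 sum_ennreal)
    qed simp
  qed
  also have "\<dots> = (\<Sum>k<N. I) + ennreal b * ennreal (real N * (e / b))"
  proof (subst nn_integral_add)
    show "(\<integral>\<^sup>+v. (\<Sum>k<N. indicator ?B v * ennreal (u (z + r *\<^sub>R (w ^ k *s v)))) \<partial>lborel)
        + (\<integral>\<^sup>+v. indicator ?B v * ennreal (real N * (e / b)) \<partial>lborel) = (\<Sum>k<N. I) + ennreal b * ennreal (real N * (e / b))"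
      by (subst nn_integral_sum) (simp_all add: rot nn_integral_multc eb)
  qed measurable
  also have "\<dots> = ennreal (real N) * (I + ennreal e)"
  proof -
    have "ennreal b * ennreal (real N * (e / b)) = ennreal (real N) * ennreal e"
      using e b by (simp add: ennreal_mult[symmetric])
    then show ?thesis by (simp add: distrib_left ennreal_of_nat_eq_real_of_nat)
  qed
  finally have "ennreal (u z) * ennreal b \<le> I + ennreal e"
    using N(1) by (subst (asm) ennreal_mult_le_mult_iff) auto
  then show "ennreal (log_plus (cmod (f z))) * emeasure lborel ?B \<le>
      (\<integral>\<^sup>+v. indicator ?B v * ennreal (log_plus (cmod (f (z + r *\<^sub>R v)))) \<partial>lborel) + ennreal e"
    by (simp add: eb I_def u_def)
qed

section \<open>Pointwise growth of functions of finite order\<close>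

abbreviation shell :: "(complex^'m) set" where
  "shell \<equiv> {x. 1 < norm x \<and> norm x < 2}"

definition shell_density_bound :: "'m::finite itself \<Rightarrow> real" where
  "shell_density_bound _ = (1 / (pi * 4)) ^ (CARD('m) - 1) / 2 ^ CARD('m) / (4 * pi)"

lemma nevanlinna_T_eq:
  fixes f :: "complex^'m \<Rightarrow> complex"
  assumes "r > 0"
  shows "nevanlinna_T r f = (LINT x : shell | lborel. log_plus (cmod (f (radial_proj r x))) * shell_density x)"
  unfolding nevanlinna_T_def sphere_integral_eq[OF assms] by simp

text \<open>
  The Nevanlinna characteristic is an integral against a density that is bounded below. Integrability has to be
  checked, as the Bochner integral of a non-integrable function would be \<open>0\<close>.
\<close>

lemma shell_integral_le_nevanlinna_T:
  fixes f :: "complex^'m \<Rightarrow> complex"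
  assumes f: "entire_Cm f" and r: "r > 0"
  shows "ennreal (shell_density_bound TYPE('m)) *
      (\<integral>\<^sup>+x. indicator shell x * ennreal (log_plus (cmod (f (radial_proj r x)))) \<partial>lborel) \<le> ennreal (nevanlinna_T r f)"
    and "nevanlinna_T r f \<ge> 0"
proof -
  let ?w = "shell_density_bound TYPE('m)"
  define u where "u z = log_plus (cmod (f z))" for z
  have u0: "u z \<ge> 0" for z by (simp add: u_def log_plus_nonneg)
  have w0: "?w \<ge> 0" by (simp add: shell_density_bound_def)
  have cu: "continuous_on S u" for S unfolding u_def by (rule log_plus_entire_continuous[OF f])
  have low: "?w \<le> shell_density x" if "x \<in> shell" for x :: "complex^'m"
    using shell_density_lower[of x] that by (simp add: shell_density_bound_def)
  define g where "g x = u (radial_proj r x) * shell_density x" for x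
  let ?A = "cball 0 2 - ball 0 1 :: (complex^'m) set"
  have A: "compact ?A" by (intro compact_diff) auto
  have sub: "shell \<subseteq> ?A" by auto
  have "?A \<subseteq> {x. x \<noteq> 0}" by auto
  then have "continuous_on ?A g"
    unfolding g_def radial_proj_def
    by (intro continuous_intros continuous_on_compose2[OF cu[of UNIV]] continuous_on_subset[OF continuous_on_shell_density]) auto
  then have "set_integrable lborel ?A g"
    unfolding set_integrable_def by (rule borel_integrable_compact[OF A])
  moreover have "shell \<in> sets (lborel :: (complex^'m) measure)"
  proof -
    have "(shell :: (complex^'m) set) = ball 0 2 - cball 0 1" by auto
    then show ?thesis by simp
  qed
  ultimately have int: "set_integrable lborel shell g" using sub by (rule set_integrable_subset)
  have T: "nevanlinna_T r f = (LINT x : shell | lborel. g x)"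
    unfolding g_def u_def by (rule nevanlinna_T_eq[OF r])
  have g0: "g x \<ge> 0" if "x \<in> shell" for x
    unfolding g_def using low[OF that] w0 u0 by (intro mult_nonneg_nonneg) auto
  show "nevanlinna_T r f \<ge> 0"
    unfolding T set_lebesgue_integral_def
    by (intro Bochner_Integration.integral_nonneg) (use g0 in \<open>auto simp: indicator_def\<close>)
  have [measurable]: "u \<in> borel_measurable borel"
    using cu[of UNIV] by (rule borel_measurable_continuous_onI)
  have [measurable]: "(radial_proj r :: complex^'m \<Rightarrow> _) \<in> borel_measurable borel"
    unfolding radial_proj_def[abs_def] by measurable
  have [measurable]: "shell \<in> sets (borel :: (complex^'m) measure)"
    using \<open>shell \<in> sets (lborel :: (complex^'m) measure)\<close> by simp
  have "ennreal ?w * (\<integral>\<^sup>+x. indicator shell x * ennreal (u (radial_proj r x)) \<partial>lborel)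
      = (\<integral>\<^sup>+x. ennreal ?w * (indicator shell x * ennreal (u (radial_proj r x))) \<partial>lborel)"
    by (rule nn_integral_cmult[symmetric]) measurable
  also have "\<dots> \<le> (\<integral>\<^sup>+x. ennreal (indicator shell x *\<^sub>R g x) \<partial>lborel)"
  proof (rule nn_integral_mono)
    fix x :: "complex^'m"
    show "ennreal ?w * (indicator shell x * ennreal (u (radial_proj r x))) \<le> ennreal (indicator shell x *\<^sub>R g x)"
    proof (cases "x \<in> shell")
      case True
      then have "?w * u (radial_proj r x) \<le> g x"
        unfolding g_def using mult_right_mono[OF low u0] by (simp add: mult.commute)
      then show ?thesis using True w0 u0 by (simp add: ennreal_mult[symmetric] ennreal_leI)
    qed simp
  qed
  also have "\<dots> = ennreal (LINT x : shell | lborel. g x)"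
    unfolding set_lebesgue_integral_def
    by (intro nn_integral_eq_integral int[unfolded set_integrable_def]) (use g0 in \<open>auto simp: indicator_def\<close>)
  finally show "ennreal ?w *
      (\<integral>\<^sup>+x. indicator shell x * ennreal (log_plus (cmod (f (radial_proj r x)))) \<partial>lborel) \<le> ennreal (nevanlinna_T r f)"
    by (simp add: u_def T)
qed

lemma finite_order_nevanlinna_bound:
  fixes f :: "complex^'m \<Rightarrow> complex"
  assumes f: "entire_Cm f" and fin: "finite_order_Cm f"
  obtains K R where "R \<ge> 1" "\<And>r. r \<ge> R \<Longrightarrow> nevanlinna_T r f \<le> r ^ K"
proof -
  obtain K :: nat where "order_Cm f < ereal (real K)"
    using fin less_PInf_Ex_of_nat[of "order_Cm f"] unfolding finite_order_Cm_def by auto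
  then have "eventually (\<lambda>r. (if nevanlinna_T r f = 0 then -\<infinity> else ereal (ln (nevanlinna_T r f) / ln r)) < ereal (real K)) at_top"
    unfolding order_Cm_def by (rule Limsup_lessD)
  then obtain R where R: "\<And>r. r \<ge> R \<Longrightarrow> (if nevanlinna_T r f = 0 then -\<infinity> else ereal (ln (nevanlinna_T r f) / ln r)) < ereal (real K)"
    unfolding eventually_at_top_linorder by auto
  show thesis
  proof (rule that[of "max R 2" K])
    fix r assume r: "r \<ge> max R 2"
    show "nevanlinna_T r f \<le> r ^ K"
    proof (cases "nevanlinna_T r f = 0")
      case False
      then have pos: "nevanlinna_T r f > 0"
        using shell_integral_le_nevanlinna_T(2)[OF f, of r] r by simp
      have "ln (nevanlinna_T r f) / ln r < real K" using R[of r] r False by simp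
      then have "ln (nevanlinna_T r f) < real K * ln r" using r by (simp add: field_simps)
      also have "\<dots> = ln (r ^ K)" using r by (simp add: ln_realpow)
      finally show ?thesis using pos r by simp
    qed (use r in simp)
  qed simp
qed

text \<open>
  The substitution \<open>t = \<bar>x\<bar> \<tau>\<close> compares an integral over dilations of \<open>x\<close> with one over radii of spheres. It
  maps \<open>[1, 5/4]\<close> into \<open>[1, 4]\<close> because \<open>1 < \<bar>x\<bar> < 2\<close>.
\<close>

lemma ray_integral_le:
  fixes u :: "complex^'m \<Rightarrow> real"
  assumes u[measurable]: "u \<in> borel_measurable borel" and x: "x \<in> shell"
  shows "(\<integral>\<^sup>+\<tau>. indicator {1..5/4} \<tau> * ennreal (u ((R * \<tau>) *\<^sub>R x)) \<partial>lborel)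
    \<le> (\<integral>\<^sup>+t. indicator {1..4} t * ennreal (u (radial_proj (R * t) x)) \<partial>lborel)"
proof -
  define n where "n = norm x"
  have n: "1 < n" "n < 2" using x by (simp_all add: n_def)
  let ?g = "\<lambda>t. indicator {1..4} t * ennreal (u (radial_proj (R * t) x))"
  have "(\<integral>\<^sup>+\<tau>. indicator {1..5/4} \<tau> * ennreal (u ((R * \<tau>) *\<^sub>R x)) \<partial>lborel) \<le> (\<integral>\<^sup>+\<tau>. ?g (0 + n * \<tau>) \<partial>lborel)"
  proof (rule nn_integral_mono)
    fix \<tau> :: real
    show "indicator {1..5/4} \<tau> * ennreal (u ((R * \<tau>) *\<^sub>R x)) \<le> ?g (0 + n * \<tau>)"
    proof (cases "\<tau> \<in> {1..5/4}")
      case True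
      then have "1 * 1 \<le> n * \<tau>" "n * \<tau> \<le> 2 * (5/4)"
        using n by (intro mult_mono; simp)+
      then have "n * \<tau> \<in> {1..4}" by simp
      moreover have "radial_proj (R * (n * \<tau>)) x = (R * \<tau>) *\<^sub>R x"
        using n by (simp add: radial_proj_def n_def[symmetric])
      ultimately show ?thesis using True by simp
    qed simp
  qed
  also have "\<dots> \<le> ennreal \<bar>n\<bar> * \<dots>"
    using n mult_right_mono[of 1 "ennreal \<bar>n\<bar>" "\<integral>\<^sup>+\<tau>. ?g (0 + n * \<tau>) \<partial>lborel"] by simp
  also have "\<dots> = (\<integral>\<^sup>+t. ?g t \<partial>lborel)"
    by (rule nn_integral_real_affine[symmetric]) (use n in \<open>auto simp: radial_proj_def\<close>)
  finally show ?thesis .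
qed

text \<open>
  Write \<open>u\<close> for \<open>log\<^sup>+ \<bar>f\<bar>\<close>, and let \<open>\<bar>z\<bar> = 3 R / 2\<close>. For each \<open>\<tau>\<close> in \<open>[1, 5/4]\<close> the point
  \<open>z / (R \<tau>)\<close> has distance at least \<open>1/10\<close> from the complement of the shell \<open>1 < \<bar>x\<bar> < 2\<close>, so by
  the sub-mean value property \<open>u(z)\<close> is at most a constant times the integral of \<open>u(R \<tau> x)\<close> over that shell.
  Integrating over \<open>\<tau>\<close> and exchanging the integrals (twice) replaces \<open>u(R \<tau> x)\<close> by the values of \<open>u\<close> on the spheres of
  radius \<open>R t\<close>, \<open>1 \<le> t \<le> 4\<close>, and these are controlled by the characteristic.
\<close>

lemma log_plus_polynomial_growth:
  fixes f :: "complex^'m \<Rightarrow> complex"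
  assumes f: "entire_Cm f" and fin: "finite_order_Cm f"
  obtains A K where "A \<ge> 0" "\<And>z. log_plus (cmod (f z)) \<le> A * (1 + norm z) ^ K"
proof -
  obtain K R0 where R0: "R0 \<ge> 1" and T: "\<And>r. r \<ge> R0 \<Longrightarrow> nevanlinna_T r f \<le> r ^ K"
    using finite_order_nevanlinna_bound[OF f fin] by metis
  define u where "u z = log_plus (cmod (f z))" for z
  have u0: "u z \<ge> 0" for z by (simp add: u_def log_plus_nonneg)
  have cu: "continuous_on UNIV u" unfolding u_def by (rule log_plus_entire_continuous[OF f])
  then have [measurable]: "u \<in> borel_measurable borel" by (rule borel_measurable_continuous_onI)
  have [measurable]: "shell \<in> sets (borel :: (complex^'m) measure)"
  proof -
    have "(shell :: (complex^'m) set) = ball 0 2 - cball 0 1" by auto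
    then show ?thesis by simp
  qed
  define w where "w = shell_density_bound TYPE('m)"
  have w: "w > 0" by (simp add: w_def shell_density_bound_def)
  let ?B = "cball (0 :: complex^'m) (1/10)"
  define b where "b = measure lborel ?B"
  have b: "b > 0" unfolding b_def using content_cball_pos[of "1/10" "0 :: complex^'m"] by simp
  have eb: "emeasure lborel ?B = ennreal b"
    unfolding b_def using emeasure_lborel_cball_finite[of "0 :: complex^'m" "1/10"]
    by (subst emeasure_eq_ennreal_measure) auto
  \<comment> \<open>\<open>12 = 3 / (1/4)\<close> is the ratio of the lengths of the intervals \<open>[1, 4]\<close> and \<open>[1, 5/4]\<close>.\<close>
  define C where "C = 12 * 4 ^ K / (w * b)"
  have C0: "C \<ge> 0" using w b by (simp add: C_def)
  have large: "u z \<le> C * R ^ K" if R: "R \<ge> R0" and z: "norm z = 3 / 2 * R" for z R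
  proof -
    have R1: "R \<ge> 1" using R R0 by simp
    have sub: "ennreal (u z * b) \<le> (\<integral>\<^sup>+x. indicator shell x * ennreal (u ((R * \<tau>) *\<^sub>R x)) \<partial>lborel)"
      if \<tau>: "\<tau> \<in> {1..5/4}" for \<tau>
    proof -
      define y where "y = (1 / (R * \<tau>)) *\<^sub>R z"
      have R\<tau>: "R * \<tau> > 0" using R1 \<tau> by simp
      have zy: "(R * \<tau>) *\<^sub>R y = z" using R1 \<tau> by (simp add: y_def)
      have ny: "norm y = 3 / 2 / \<tau>" using R1 \<tau> z by (simp add: y_def field_simps)
      have ny': "6/5 \<le> norm y" "norm y \<le> 3/2" using \<tau> unfolding ny by (simp_all add: field_simps)
      have "ennreal (u z * b) = ennreal (u z) * emeasure lborel ?B"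
        using u0 b by (simp add: eb ennreal_mult)
      also have "\<dots> \<le> (\<integral>\<^sup>+v. indicator ?B v * ennreal (u (z + (R * \<tau>) *\<^sub>R v)) \<partial>lborel)"
        unfolding u_def by (rule log_plus_sub_mean_value[OF f _ R\<tau>]) simp
      also have "\<dots> \<le> (\<integral>\<^sup>+v. indicator shell (y + v) * ennreal (u ((R * \<tau>) *\<^sub>R (y + v))) \<partial>lborel)"
      proof (rule nn_integral_mono)
        fix v
        show "indicator ?B v * ennreal (u (z + (R * \<tau>) *\<^sub>R v)) \<le> indicator shell (y + v) * ennreal (u ((R * \<tau>) *\<^sub>R (y + v)))"
        proof (cases "v \<in> ?B")
          case True
          then have "norm v \<le> 1/10" by simp
          then have "y + v \<in> shell" using ny' norm_triangle_ineq[of y v] norm_diff_ineq[of y v] by simp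
          then show ?thesis using True by (simp add: scaleR_add_right zy)
        qed simp
      qed
      also have "\<dots> = (\<integral>\<^sup>+x. indicator shell x * ennreal (u ((R * \<tau>) *\<^sub>R x)) \<partial>lborel)"
        by (rule nn_integral_lborel_translate) measurable
      finally show ?thesis .
    qed
    have "ennreal (1/4 * (u z * b)) = (\<integral>\<^sup>+\<tau>. indicator {1..5/4} \<tau> * ennreal (u z * b) \<partial>(lborel :: real measure))"
      using u0 b by (subst nn_integral_multc) (auto simp: ennreal_mult[symmetric])
    also have "\<dots> \<le> (\<integral>\<^sup>+\<tau>. \<integral>\<^sup>+x. indicator {1..5/4} \<tau> * (indicator shell x * ennreal (u ((R * \<tau>) *\<^sub>R x))) \<partial>lborel \<partial>lborel)"
    proof (rule nn_integral_mono)
      fix \<tau> :: real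
      show "indicator {1..5/4} \<tau> * ennreal (u z * b)
        \<le> (\<integral>\<^sup>+x. indicator {1..5/4} \<tau> * (indicator shell x * ennreal (u ((R * \<tau>) *\<^sub>R x))) \<partial>lborel)"
        using sub[of \<tau>] by (cases "\<tau> \<in> {1..5/4}") auto
    qed
    also have "\<dots> = (\<integral>\<^sup>+x. \<integral>\<^sup>+\<tau>. indicator {1..5/4} \<tau> * (indicator shell x * ennreal (u ((R * \<tau>) *\<^sub>R x))) \<partial>lborel \<partial>lborel)"
      by (rule lborel_pair.Fubini') measurable
    also have "\<dots> \<le> (\<integral>\<^sup>+x. \<integral>\<^sup>+t. indicator {1..4} t * (indicator shell x * ennreal (u (radial_proj (R * t) x))) \<partial>lborel \<partial>lborel)"
    proof (rule nn_integral_mono)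
      fix x :: "complex^'m"
      show "(\<integral>\<^sup>+\<tau>. indicator {1..5/4} \<tau> * (indicator shell x * ennreal (u ((R * \<tau>) *\<^sub>R x))) \<partial>lborel)
        \<le> (\<integral>\<^sup>+t. indicator {1..4} t * (indicator shell x * ennreal (u (radial_proj (R * t) x))) \<partial>lborel)"
        using ray_integral_le[of u x R] by (cases "x \<in> shell") auto
    qed
    also have "\<dots> = (\<integral>\<^sup>+t. \<integral>\<^sup>+x. indicator {1..4} t * (indicator shell x * ennreal (u (radial_proj (R * t) x))) \<partial>lborel \<partial>lborel)"
      unfolding radial_proj_def by (rule lborel_pair.Fubini'[symmetric]) measurable
    also have "\<dots> \<le> (\<integral>\<^sup>+t. indicator {1..4} t * ennreal ((4 * R) ^ K / w) \<partial>(lborel :: real measure))"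
    proof (rule nn_integral_mono)
      fix t :: real
      show "(\<integral>\<^sup>+x. indicator {1..4} t * (indicator shell x * ennreal (u (radial_proj (R * t) x))) \<partial>lborel)
        \<le> indicator {1..4} t * ennreal ((4 * R) ^ K / w)"
      proof (cases "t \<in> {1..4}")
        case True
        then have Rt: "R0 \<le> R * t" "R * t \<le> 4 * R" "R * t > 0"
          using R R1 mult_mono[of R0 R 1 t] R0 by (auto simp: mult.commute)
        let ?I = "\<integral>\<^sup>+x. indicator shell x * ennreal (u (radial_proj (R * t) x)) \<partial>lborel"
        have "ennreal w * ?I \<le> ennreal (nevanlinna_T (R * t) f)"
          unfolding u_def w_def by (rule shell_integral_le_nevanlinna_T(1)[OF f Rt(3)])
        also have "\<dots> \<le> ennreal ((4 * R) ^ K)"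
          using T[OF Rt(1)] power_mono[OF Rt(2), of K] Rt(3) by (intro ennreal_leI) auto
        also have "\<dots> = ennreal w * ennreal ((4 * R) ^ K / w)"
          using w R1 by (simp add: ennreal_mult[symmetric])
        finally have "?I \<le> ennreal ((4 * R) ^ K / w)"
          using w by (subst (asm) ennreal_mult_le_mult_iff) auto
        then show ?thesis using True by simp
      qed simp
    qed
    also have "\<dots> = ennreal (3 * ((4 * R) ^ K / w))"
    proof -
      have q: "(4 * R) ^ K / w \<ge> 0" using w R1 by simp
      have "(\<integral>\<^sup>+t. indicator {1..4} t * ennreal ((4 * R) ^ K / w) \<partial>(lborel :: real measure))
          = 3 * ennreal ((4 * R) ^ K / w)"
        by (subst nn_integral_multc) auto
      also have "\<dots> = ennreal (3 * ((4 * R) ^ K / w))" using q by (subst ennreal_mult) auto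
      finally show ?thesis .
    qed
    finally have le: "1/4 * (u z * b) \<le> 3 * ((4 * R) ^ K / w)"
      using w R1 by (subst (asm) ennreal_le_iff) auto
    have "u z = 4 * (1/4 * (u z * b)) / b" using b by simp
    also have "\<dots> \<le> 4 * (3 * ((4 * R) ^ K / w)) / b"
      using le b by (intro divide_right_mono mult_left_mono) auto
    also have "\<dots> = C * R ^ K" by (simp add: C_def power_mult_distrib)
    finally show "u z \<le> C * R ^ K" .
  qed
  have "compact (u ` cball 0 (3 / 2 * R0))"
    by (intro compact_continuous_image continuous_on_subset[OF cu]) auto
  then have "bdd_above (u ` cball 0 (3 / 2 * R0))"
    by (intro bounded_imp_bdd_above compact_imp_bounded)
  then obtain M where "\<forall>y \<in> u ` cball 0 (3 / 2 * R0). y \<le> M"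
    unfolding bdd_above_def by blast
  then have M: "u z \<le> M" if "norm z \<le> 3 / 2 * R0" for z
    using that by simp
  define A where "A = max C M"
  have A: "A \<ge> 0" "C \<le> A" "M \<le> A" using C0 by (auto simp: A_def)
  have bound: "u z \<le> A * (1 + norm z) ^ K" for z
  proof (cases "norm z \<le> 3 / 2 * R0")
    case True
    have "u z \<le> A * 1" using M[OF True] A by simp
    also have "\<dots> \<le> A * (1 + norm z) ^ K" using A by (intro mult_left_mono one_le_power) auto
    finally show ?thesis .
  next
    case False
    then have "u z \<le> C * (2 / 3 * norm z) ^ K" by (intro large) auto
    also have "\<dots> \<le> A * (1 + norm z) ^ K" using A C0 by (intro mult_mono power_mono) auto
    finally show ?thesis .
  qed
  show thesis using A(1) bound unfolding u_def by (rule that)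
qed

section \<open>The Fermat-type equation\<close>

lemma polynomial_Cm_const: "polynomial_Cm (\<lambda>z :: complex^'m. c)"
  unfolding polynomial_Cm_def
  by (rule exI[of _ "{\<lambda>_. 0}"], rule exI[of _ "\<lambda>_. c"]) simp

theorem corollary1p1:
  fixes c :: "complex^'m" and m1 m2 :: nat
  assumes "m2 = 1" and "m1 > 2"
  shows "\<not> (\<exists>f :: complex^'m \<Rightarrow> complex.
            entire_Cm f \<and> transcendental_Cm f \<and> finite_order_Cm f \<and>
            (\<forall>z. (\<Sum>j\<in>UNIV. partial_Cm j f z) ^ m1 + (f (z + c)) ^ m2 = 1))"
proof
  assume "\<exists>f :: complex^'m \<Rightarrow> complex.
            entire_Cm f \<and> transcendental_Cm f \<and> finite_order_Cm f \<and>
            (\<forall>z. (\<Sum>j\<in>UNIV. partial_Cm j f z) ^ m1 + (f (z + c)) ^ m2 = 1)"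
  then obtain f :: "complex^'m \<Rightarrow> complex" where f: "entire_Cm f" "transcendental_Cm f" "finite_order_Cm f"
    and eq: "\<And>z. diag_deriv f z ^ m1 + f (z + c) = 1"
    using assms(1) by (auto simp: diag_deriv_def)
  have n: "m1 \<ge> 3" using assms(2) by simp
  obtain A K where g: "A \<ge> 0" "\<And>z. log_plus (cmod (f z)) \<le> A * (1 + norm z) ^ K"
    by (rule log_plus_polynomial_growth[OF f(1,3)]) (rule that)
  have "f z = 1" for z
    by (rule no_slow_growth_solution[OF f(1) n eq g(2,1)])
  then have "f = (\<lambda>z. 1)" by (rule ext)
  then have "polynomial_Cm f" by (simp only: polynomial_Cm_const)
  then show False using f(2) by (simp add: transcendental_Cm_def)
qed

end
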